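(* Let $q\in(1,\infty)$ and let $p$ denote the Hölder conjugate of $q$ ($1/p+1/q=1$). For coordinate weights $\boldsymbol{\gamma}=(\gamma_j)_{j\ge1}$ in $(0,1]$ the following hold for the integration problem in $F_{d,\boldsymbol{\gamma},q}$ with positive quadrature rules. (i) A necessary condition for any notion of tractability (weak, polynomial, strong polynomial) is $\lim_{j\to\infty}\gamma_j=0$. (ii) A necessary condition for strong polynomial tractability is $\sum_{j=1}^\infty\gamma_j^{p/2}<\infty$. If $q$ is of the form $q=2\ell/(2\ell-1)$ with $\ell\in\mathbb{N}$, then this condition is also sufficient. (iii) For every $q\in(1,\infty)$ the problem is polynomially tractable if and only if $\limsup_{d\to\infty}\frac{1}{\log d}\sum_{j=1}^d\gamma_j^{p/2}<\infty$. This condition is sufficient for polynomial tractability also for $q=\infty$ (with $p=1$). (iv) For every $q\in(1,\infty)$ the problem is weakly tractable if and only if $\lim_{d\to\infty}\frac1d\sum_{j=1}^d\gamma_j^{p/2}=0$. This condition is sufficient for weak tractability also for $q=\infty$ (with $p=1$).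
   Context: Notation: $\mathbb{N}=\{1,2,\ldots\}$, $[d]=\{1,\ldots,d\}$, $\gamma_{\mathfrak{u}}=\prod_{j\in\mathfrak{u}}\gamma_j$ for $\mathfrak{u}\subseteq[d]$. For $\boldsymbol{t}\in[0,1]^d$ write $\boldsymbol{t}_{\mathfrak{u}}=(t_j)_{j\in\mathfrak{u}}$, and $(\boldsymbol{t}_{\mathfrak{u}},0)$ for the $d$-dimensional vector with $j$-th coordinate $t_j$ if $j\in\mathfrak{u}$ and $0$ otherwise. Let $W^1_q([0,1])$ be the space of absolutely continuous functions on $[0,1]$ with derivative in $L_q([0,1])$. $F_{1,\gamma,q}$ is this space with norm $\|f\|_{1,\gamma,q}=\big(|f(0)|^q+\gamma^{-q/2}\int_0^1|f'(t)|^q\,\mathrm{d}t\big)^{1/q}$. $F_{d,\boldsymbol{\gamma},q}=F_{1,\gamma_1,q}\otimes\cdots\otimes F_{1,\gamma_d,q}$ is the Sobolev space $W_q^{(1,\ldots,1)}([0,1]^d)$ of functions with dominating mixed first derivatives in $L_q$ (equivalently, $f(\boldsymbol{x})=\sum_{\mathfrak{u}\subseteq[d]}\int_{\prod_{j\in\mathfrak{u}}[0,x_j]}g_{\mathfrak{u}}(\boldsymbol{t}_{\mathfrak{u}})\,\mathrm{d}\boldsymbol{t}_{\mathfrak{u}}$ with $g_{\mathfrak{u}}=\frac{\partial^{|\mathfrak{u}|}}{\partial\boldsymbol{t}_{\mathfrak{u}}}f((\boldsymbol{t}_{\mathfrak{u}},0))\in L_q([0,1]^{|\mathfrak{u}|})$),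 with norm $$\|f\|_{d,\boldsymbol{\gamma},q}=\Big(\sum_{\mathfrak{u}\subseteq[d]}\frac{1}{\gamma_{\mathfrak{u}}^{q/2}}\int_{[0,1]^{|\mathfrak{u}|}}\Big|\frac{\partial^{|\mathfrak{u}|}}{\partial\boldsymbol{t}_{\mathfrak{u}}}f((\boldsymbol{t}_{\mathfrak{u}},0))\Big|^q\mathrm{d}\boldsymbol{t}_{\mathfrak{u}}\Big)^{1/q},$$ where the term for $\mathfrak{u}=\emptyset$ is $|f(\boldsymbol{0})|^q$; for $q=\infty$ the usual modification is used, i.e. the norm is $\max_{\mathfrak{u}\subseteq[d]}\gamma_{\mathfrak{u}}^{-1/2}\big\|\frac{\partial^{|\mathfrak{u}|}}{\partial\boldsymbol{t}_{\mathfrak{u}}}f((\boldsymbol{t}_{\mathfrak{u}},0))\big\|_{L_\infty}$. Let $I_d(f)=\int_{[0,1]^d}f(\boldsymbol{x})\,\mathrm{d}\boldsymbol{x}$. Positive quadrature rules are $A_{d,N}(f)=\sum_{k=1}^N a_kf(\boldsymbol{x}_k)$ with $\boldsymbol{x}_k\in[0,1)^d$ and $a_k\ge0$; their worst-case error is $e(F_{d,\boldsymbol{\gamma},q},A_{d,N})=\sup_{\|f\|_{d,\boldsymbol{\gamma},q}\le1}|I_d(f)-A_{d,N}(f)|$. Let $e_{q,\boldsymbol{\gamma}}(N,d)$ be the minimum (understood as an infimum) of this error over all such rules with $N$ nodes, $e_{q,\boldsymbol{\gamma}}(0,d)=\sup_{\|f\|_{d,\boldsymbol{\gamma},q}\le1}|I_d(f)|$,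 and for $\varepsilon\in(0,1)$, $d\in\mathbb{N}$, $$N^{\mathrm{int}}_{q,\boldsymbol{\gamma}}(\varepsilon,d)=\min\{N\in\mathbb{N}:e_{q,\boldsymbol{\gamma}}(N,d)\le\varepsilon\,e_{q,\boldsymbol{\gamma}}(0,d)\}.$$ The integration problem is called - weakly tractable if $\lim_{d+\varepsilon^{-1}\to\infty}\frac{\log N^{\mathrm{int}}_{q,\boldsymbol{\gamma}}(\varepsilon,d)}{d+\varepsilon^{-1}}=0$; - polynomially tractable if there are $C,\sigma>0$ and $\tau\ge0$ with $N^{\mathrm{int}}_{q,\boldsymbol{\gamma}}(\varepsilon,d)\le Cd^\tau\varepsilon^{-\sigma}$ for all $\varepsilon\in(0,1)$, $d\in\mathbb{N}$; - strongly polynomially tractable if there are $C,\sigma>0$ with $N^{\mathrm{int}}_{q,\boldsymbol{\gamma}}(\varepsilon,d)\le C\varepsilon^{-\sigma}$ for all $\varepsilon\in(0,1)$, $d\in\mathbb{N}$.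
   Formalization: In (i), for weak and polynomial tractability the weights are assumed nonincreasing; without this (i) contradicts (iii) and (iv): take γ_j=1 when j is a power of 2 and γ_j=2^{-j} otherwise. *)

theory Defs
  imports "HOL-Probability.Essential_Supremum"
begin

text \<open>Coordinates are indexed by \<open>{1..d}\<close>; a point of \<open>[0,1]\<^sup>u\<close>, for a finite set \<open>u\<close> of coordinates, is
  an extensional function on \<open>u\<close>. The value \<open>\<gamma> 0\<close> of a weight sequence is never used.\<close>

definition unit_cube :: "nat set \<Rightarrow> (nat \<Rightarrow> real) set" where
  "unit_cube u = (\<Pi>\<^sub>E j\<in>u. {0..1})"

definition cube_measure :: "nat set \<Rightarrow> (nat \<Rightarrow> real) measure" where
  "cube_measure u = Pi\<^sub>M u (\<lambda>_. restrict_space lborel {0..1})"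

definition weight_prod :: "(nat \<Rightarrow> real) \<Rightarrow> nat set \<Rightarrow> real" where
  "weight_prod \<gamma> u = (\<Prod>j\<in>u. \<gamma> j)"

text \<open>The exponent \<open>q\<close> is an extended real in order to include \<open>q = \<infinity>\<close>.\<close>

definition Linf_norm :: "'a measure \<Rightarrow> ('a \<Rightarrow> real) \<Rightarrow> ereal" where
  "Linf_norm M g = esssup M (\<lambda>t. ereal \<bar>g t\<bar>)"

definition in_Lq :: "ereal \<Rightarrow> 'a measure \<Rightarrow> ('a \<Rightarrow> real) \<Rightarrow> bool" where
  "in_Lq q M g \<longleftrightarrow> g \<in> borel_measurable M \<and>
     (if q = \<infinity> then Linf_norm M g < \<infinity>
      else integrable M (\<lambda>t. \<bar>g t\<bar> powr real_of_ereal q))"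

text \<open>\<open>g u\<close> is the (weak) mixed derivative \<open>\<partial>\<^sup>|\<^sup>u\<^sup>|f((t\<^sub>u,0))/\<partial>t\<^sub>u\<close>. For \<open>u = {}\<close> the measure
  \<open>cube_measure {}\<close> is the unit point mass at \<open>\<lambda>_. undefined\<close>, so that the corresponding summand
  is the constant \<open>g {} (\<lambda>_. undefined)\<close>; evaluating at the origin shows that it equals \<open>f(0)\<close>.\<close>

definition has_mixed_derivs ::
    "ereal \<Rightarrow> nat \<Rightarrow> ((nat \<Rightarrow> real) \<Rightarrow> real) \<Rightarrow> (nat set \<Rightarrow> (nat \<Rightarrow> real) \<Rightarrow> real) \<Rightarrow> bool" where
  "has_mixed_derivs q d f g \<longleftrightarrow>
     (\<forall>u\<subseteq>{1..d}. in_Lq q (cube_measure u) (g u)) \<and>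
     (\<forall>x\<in>unit_cube {1..d}. f x =
        (\<Sum>u\<in>Pow {1..d}. set_lebesgue_integral (cube_measure u) (\<Pi>\<^sub>E j\<in>u. {0..x j}) (g u)))"

definition sobolev_space :: "ereal \<Rightarrow> nat \<Rightarrow> ((nat \<Rightarrow> real) \<Rightarrow> real) set" where
  "sobolev_space q d = {f. \<exists>g. has_mixed_derivs q d f g}"

text \<open>The mixed derivatives are determined by \<open>f\<close> only up to null sets; the norm below does not
  depend on the chosen representatives.\<close>

definition mixed_derivs ::
    "ereal \<Rightarrow> nat \<Rightarrow> ((nat \<Rightarrow> real) \<Rightarrow> real) \<Rightarrow> nat set \<Rightarrow> (nat \<Rightarrow> real) \<Rightarrow> real" where
  "mixed_derivs q d f = (SOME g. has_mixed_derivs q d f g)"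

definition sobolev_norm ::
    "ereal \<Rightarrow> (nat \<Rightarrow> real) \<Rightarrow> nat \<Rightarrow> ((nat \<Rightarrow> real) \<Rightarrow> real) \<Rightarrow> real" where
  "sobolev_norm q \<gamma> d f =
     (if q = \<infinity> then
        Max ((\<lambda>u. weight_prod \<gamma> u powr (- (1/2)) *
                    real_of_ereal (Linf_norm (cube_measure u) (mixed_derivs q d f u))) ` Pow {1..d})
      else
        (\<Sum>u\<in>Pow {1..d}. 1 / weight_prod \<gamma> u powr (real_of_ereal q / 2) *
            (LINT t|cube_measure u. \<bar>mixed_derivs q d f u t\<bar> powr real_of_ereal q))
          powr (1 / real_of_ereal q))"

definition unit_ball :: "ereal \<Rightarrow> (nat \<Rightarrow> real) \<Rightarrow> nat \<Rightarrow> ((nat \<Rightarrow> real) \<Rightarrow> real) set" where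
  "unit_ball q \<gamma> d = {f \<in> sobolev_space q d. sobolev_norm q \<gamma> d f \<le> 1}"

definition cube_integral :: "nat \<Rightarrow> ((nat \<Rightarrow> real) \<Rightarrow> real) \<Rightarrow> real" where
  "cube_integral d f = (LINT x|cube_measure {1..d}. f x)"

definition quadrature ::
    "nat \<Rightarrow> (nat \<Rightarrow> real) \<Rightarrow> (nat \<Rightarrow> nat \<Rightarrow> real) \<Rightarrow> ((nat \<Rightarrow> real) \<Rightarrow> real) \<Rightarrow> real" where
  "quadrature N a x f = (\<Sum>k=1..N. a k * f (x k))"

definition positive_rules :: "nat \<Rightarrow> nat \<Rightarrow> ((nat \<Rightarrow> real) \<times> (nat \<Rightarrow> nat \<Rightarrow> real)) set" where
  "positive_rules N d =
     {(a, x). \<forall>k\<in>{1..N}. 0 \<le> a k \<and> x k \<in> (\<Pi>\<^sub>E j\<in>{1..d}. {0..<1})}"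

definition worst_case_error ::
    "ereal \<Rightarrow> (nat \<Rightarrow> real) \<Rightarrow> nat \<Rightarrow> (((nat \<Rightarrow> real) \<Rightarrow> real) \<Rightarrow> real) \<Rightarrow> ereal" where
  "worst_case_error q \<gamma> d A = (SUP f\<in>unit_ball q \<gamma> d. ereal \<bar>cube_integral d f - A f\<bar>)"

definition minimal_error :: "ereal \<Rightarrow> (nat \<Rightarrow> real) \<Rightarrow> nat \<Rightarrow> nat \<Rightarrow> ereal" where
  "minimal_error q \<gamma> N d =
     (INF (a, x)\<in>positive_rules N d. worst_case_error q \<gamma> d (quadrature N a x))"

definition initial_error :: "ereal \<Rightarrow> (nat \<Rightarrow> real) \<Rightarrow> nat \<Rightarrow> ereal" where
  "initial_error q \<gamma> d = (SUP f\<in>unit_ball q \<gamma> d. ereal \<bar>cube_integral d f\<bar>)"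

text \<open>The set of admissible \<open>N\<close> is nonempty for \<open>1 < q \<le> \<infinity>\<close>, \<open>\<epsilon> \<in> (0,1)\<close> and positive
  weights, because the minimal errors tend to \<open>0\<close> as \<open>N\<close> grows.\<close>

definition information_complexity :: "ereal \<Rightarrow> (nat \<Rightarrow> real) \<Rightarrow> real \<Rightarrow> nat \<Rightarrow> nat" where
  "information_complexity q \<gamma> \<epsilon> d =
     (LEAST N. 1 \<le> N \<and> minimal_error q \<gamma> N d \<le> ereal \<epsilon> * initial_error q \<gamma> d)"

definition weakly_tractable :: "ereal \<Rightarrow> (nat \<Rightarrow> real) \<Rightarrow> bool" where
  "weakly_tractable q \<gamma> \<longleftrightarrow>
     ((\<lambda>(d, \<epsilon>). ln (real (information_complexity q \<gamma> \<epsilon> d)) / (real d + 1 / \<epsilon>)) \<longlongrightarrow> 0)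
       (inf (filtercomap (\<lambda>(d, \<epsilon>). real d + 1 / \<epsilon>) at_top) (principal ({1..} \<times> {0<..<1})))"

definition polynomially_tractable :: "ereal \<Rightarrow> (nat \<Rightarrow> real) \<Rightarrow> bool" where
  "polynomially_tractable q \<gamma> \<longleftrightarrow>
     (\<exists>C \<sigma> \<tau>. C > 0 \<and> \<sigma> > 0 \<and> \<tau> \<ge> 0 \<and>
        (\<forall>\<epsilon>\<in>{0<..<1}. \<forall>d\<ge>1.
           real (information_complexity q \<gamma> \<epsilon> d) \<le> C * real d powr \<tau> * \<epsilon> powr (- \<sigma>)))"

definition strongly_polynomially_tractable :: "ereal \<Rightarrow> (nat \<Rightarrow> real) \<Rightarrow> bool" where
  "strongly_polynomially_tractable q \<gamma> \<longleftrightarrow>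
     (\<exists>C \<sigma>. C > 0 \<and> \<sigma> > 0 \<and>
        (\<forall>\<epsilon>\<in>{0<..<1}. \<forall>d\<ge>1.
           real (information_complexity q \<gamma> \<epsilon> d) \<le> C * \<epsilon> powr (- \<sigma>)))"

end

theory Submission
  imports Defs "HOL-Probability.Probability"
begin

text \<open>Integrating the representation of \<open>f\<close> by its mixed derivatives \<open>g u\<close> gives
  \<open>I(f) - A(f) = \<Sum>\<^sub>u \<integral> g u * D u\<close>, where
  \<open>D u t = \<Prod>\<^sub>j (1 - t\<^sub>j) - \<Sum>\<^sub>k a\<^sub>k 1[t \<le> x\<^sub>k]\<close> is a local discrepancy, so by Hoelder's
  inequality the error of a rule is governed by \<open>\<Sum>\<^sub>u \<gamma>\<^sub>u\<^sup>p\<^sup>/\<^sup>2 \<integral> \<bar>D u\<bar>\<^sup>p\<close>. Put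
  \<open>s = \<Sum>\<^sub>j \<gamma>\<^sub>j\<^sup>p\<^sup>/\<^sup>2\<close>.

  Upper bound: nodes chosen one after the other, each not worse than the average over the cube, make
  this quantity at most \<open>N\<^sup>-\<^sup>1\<^sup>/\<^sup>2 exp s\<close>, while the initial error is at least \<open>1\<close> because of
  the constant function. Hence the information complexity is at most a multiple of
  \<open>\<epsilon>\<^sup>-\<^sup>2\<^sup>p exp (2 s)\<close>.

  Lower bound: the worst-case function of the initial problem is the product of the functions
  \<open>h\<^sub>j(x) = 1 + \<gamma>\<^sub>j\<^sup>p\<^sup>/\<^sup>2 (1 - (1 - x)\<^sup>p) / p\<close>. A positive rule that integrates it well must put a large
  weight on some node; but the interpolant of minimal norm at this node has a norm smaller by a factor
  \<open>exp (- c s)\<close>. Hence the information complexity for \<open>\<epsilon> = 1/2\<close> is at least a multiple of \<open>exp (c s)\<close>.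

  All the tractability statements follow from these two bounds.\<close>

section \<open>Lebesgue measure on the unit cube\<close>

text \<open>The decisive estimate is one-dimensional. In each coordinate integration is represented
  by \<open>1 - t\<close> and evaluation at \<open>y\<close> by the step function
  \<open>1[t \<le> y]\<close>. The function extremal for the former is never close to extremal for
  the latter, so pairing them loses a factor \<open>exp (- c * w)\<close> in Hoelder's inequality,
  with \<open>c\<close> independent of \<open>y\<close> and of the weight \<open>w\<close>. All
  kernels and test functions are products, hence the losses multiply. Positivity of the rule enters
  because the interpolants are nonnegative: without cancellation, the contribution of one node is at
  most the whole quadrature sum.

  The two bounds differ by constant factors in the exponent. This is harmless, since
  \<open>s\<close> being bounded, \<open>O(ln d)\<close> or \<open>o(d)\<close> is unaffected by
  such factors; a discrepancy bound with the Monte Carlo rate is therefore sharp enough.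

  An obstacle is the norm, which is defined through an arbitrary choice of mixed derivatives. An
  error bound over the unit ball can work with whatever was chosen, but placing an explicit function
  in the ball requires uniqueness up to null sets.\<close>

abbreviation unit_interval :: "real measure" where
  "unit_interval \<equiv> restrict_space lborel {0..1}"

lemma space_unit_interval [simp]: "space unit_interval = {0..1}"
  by (simp add: space_restrict_space)

lemma prob_space_unit_interval: "prob_space unit_interval"
  by (rule prob_space_restrict_space) auto

interpretation U: prob_space unit_interval
  by (rule prob_space_unit_interval)

interpretation UU: product_sigma_finite "\<lambda>_::nat. unit_interval"
  by standard

lemma prob_space_cube: "prob_space (cube_measure u)"
  unfolding cube_measure_def by (intro prob_space_PiM prob_space_unit_interval)

interpretation C: prob_space "cube_measure u" for u
  by (rule prob_space_cube)

lemma space_cube [simp]: "space (cube_measure u) = unit_cube u"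
  by (auto simp: cube_measure_def unit_cube_def space_PiM)

lemma component_measurable [measurable]: "j \<in> u \<Longrightarrow> (\<lambda>t. t j) \<in> borel_measurable (cube_measure u)"
  unfolding cube_measure_def
  by (rule measurable_compose[OF measurable_component_singleton])
     (auto intro!: measurable_restrict_space1)

lemma cube_integral_prod:
  fixes f :: "nat \<Rightarrow> real \<Rightarrow> real"
  assumes "finite u" "\<And>j. j \<in> u \<Longrightarrow> integrable unit_interval (f j)"
  shows "(LINT t|cube_measure u. (\<Prod>j\<in>u. f j (t j))) = (\<Prod>j\<in>u. integral\<^sup>L unit_interval (f j))"
  unfolding cube_measure_def by (rule UU.product_integral_prod[OF assms])

lemma integrable_unit_interval:
  fixes f :: "real \<Rightarrow> real"
  assumes [measurable]: "f \<in> borel_measurable borel" and "\<And>t. t \<in> {0..1} \<Longrightarrow> \<bar>f t\<bar> \<le> B"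
  shows "integrable unit_interval f"
proof (rule U.integrable_const_bound)
  show "AE x in unit_interval. norm (f x) \<le> B"
    using assms(2) by (intro AE_I2) auto
qed (auto intro: measurable_restrict_space1)

lemma integrable_cube:
  fixes f :: "(nat \<Rightarrow> real) \<Rightarrow> real"
  assumes "f \<in> borel_measurable (cube_measure u)" and "\<And>t. t \<in> unit_cube u \<Longrightarrow> \<bar>f t\<bar> \<le> B"
  shows "integrable (cube_measure u) f"
  using assms by (intro C.integrable_const_bound[where B = B] AE_I2) auto

lemma unit_cubeD: "t \<in> unit_cube u \<Longrightarrow> j \<in> u \<Longrightarrow> 0 \<le> t j \<and> t j \<le> 1"
  by (auto simp: unit_cube_def PiE_iff)

lemma integral_unit_interval:
  fixes f :: "real \<Rightarrow> real"
  assumes "(f has_integral I) {0..1}" "f \<in> borel_measurable borel" "\<And>t. t \<in> {0..1} \<Longrightarrow> \<bar>f t\<bar> \<le> B"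
  shows "integral\<^sup>L unit_interval f = I"
proof -
  have "set_integrable lborel {0..1} f"
    using integrable_unit_interval[OF assms(2,3)] by (simp add: integrable_restrict_space set_integrable_def)
  then have "(LINT x:{0..1}|lborel. f x) = integral {0..1} f"
    by (rule set_borel_integral_eq_integral(2))
  then show ?thesis
    using assms(1) by (simp add: integral_restrict_space set_lebesgue_integral_def integral_unique)
qed

text \<open>Only the upper constraints are tested; on the unit cube this is the indicator of the box
  from the origin to \<open>x\<close>. In this form it factors over coordinates, and it can equally
  be read as a function of \<open>x\<close>: the indicator of the points that dominate
  \<open>t\<close>.\<close>

definition box_ind :: "nat set \<Rightarrow> (nat \<Rightarrow> real) \<Rightarrow> (nat \<Rightarrow> real) \<Rightarrow> real" where
  "box_ind u x t = (if \<forall>j\<in>u. t j \<le> x j then 1 else 0)"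

text \<open>The volume of the box between \<open>t\<close> and the corner with all coordinates 1,
  that is, the mean of \<open>box_ind u x t\<close> over \<open>x\<close>.\<close>

definition corner_volume :: "nat set \<Rightarrow> (nat \<Rightarrow> real) \<Rightarrow> real" where
  "corner_volume u t = (\<Prod>j\<in>u. 1 - t j)"

lemma box_ind_prod: "finite u \<Longrightarrow> box_ind u x t = (\<Prod>j\<in>u. if t j \<le> x j then 1 else 0)"
  by (auto simp: box_ind_def)

lemma box_ind_bounds: "0 \<le> box_ind u x t" "box_ind u x t \<le> 1" "\<bar>box_ind u x t\<bar> \<le> 1"
  by (auto simp: box_ind_def)

lemma indicator_box:
  "t \<in> unit_cube u \<Longrightarrow> indicator (\<Pi>\<^sub>E j\<in>u. {0..x j}) t = box_ind u x t"
  by (auto simp: box_ind_def indicator_def unit_cube_def PiE_iff)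

lemma corner_volume_bounds:
  "t \<in> unit_cube u \<Longrightarrow> 0 \<le> corner_volume u t \<and> corner_volume u t \<le> 1"
  using unit_cubeD[of t u] by (auto simp: corner_volume_def intro!: prod_nonneg prod_le_1)

lemma corner_volume_measurable [measurable]:
  "corner_volume u \<in> borel_measurable (cube_measure u)"
  unfolding corner_volume_def by (intro borel_measurable_prod) auto

lemma box_ind_measurable [measurable]:
  assumes "finite u"
  shows "box_ind u x \<in> borel_measurable (cube_measure u)"
proof -
  have "(\<lambda>t. if t j \<le> x j then 1 else (0::real)) \<in> borel_measurable (cube_measure u)" if [measurable]: "j \<in> u" for j
    by measurable
  then have "(\<lambda>t. box_ind u x t) \<in> borel_measurable (cube_measure u)"
    using assms by (simp add: box_ind_prod borel_measurable_prod)
  then show ?thesis by simp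
qed

lemma box_ind_measurable_pair:
  assumes "finite u" "u \<subseteq> D"
  shows "(\<lambda>(x, t). box_ind u x t) \<in> borel_measurable (cube_measure D \<Otimes>\<^sub>M cube_measure u)"
proof -
  have "(\<lambda>z. if snd z j \<le> fst z j then 1 else (0::real)) \<in>
      borel_measurable (cube_measure D \<Otimes>\<^sub>M cube_measure u)" if j: "j \<in> u" for j
  proof -
    have [measurable]: "(\<lambda>z. fst z j) \<in> borel_measurable (cube_measure D \<Otimes>\<^sub>M cube_measure u)"
      using j assms by (intro measurable_compose[OF measurable_fst component_measurable]) auto
    have [measurable]: "(\<lambda>z. snd z j) \<in> borel_measurable (cube_measure D \<Otimes>\<^sub>M cube_measure u)"
      using j by (intro measurable_compose[OF measurable_snd component_measurable]) auto
    show ?thesis by measurable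
  qed
  then show ?thesis
    using assms(1) by (simp add: box_ind_prod case_prod_unfold borel_measurable_prod)
qed

lemma integral_step:
  assumes "0 \<le> s" "s \<le> 1"
  shows "(LINT x|unit_interval. (if s \<le> x then 1 else 0)) = 1 - s"
proof (rule integral_unit_interval[of _ _ 1])
  have "((\<lambda>x. 1::real) has_integral (1 - s)) {s..1}"
    using has_integral_const_real[of "1::real" s 1] assms by simp
  then have "((\<lambda>x. if x \<in> {s..1} then 1 else 0::real) has_integral (1 - s)) {0..1}"
    using assms by (subst has_integral_restrict) auto
  then show "((\<lambda>x. if s \<le> x then 1 else 0) has_integral 1 - s) {0..1}"
    by (rule has_integral_eq[rotated]) auto
qed auto

lemma integral_box_ind:
  assumes D: "finite D" and u: "u \<subseteq> D" and t: "t \<in> unit_cube u"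
  shows "(LINT x|cube_measure D. box_ind u x t) = corner_volume u t"
proof -
  let ?f = "\<lambda>j x. if j \<in> u then (if t j \<le> x then 1 else 0) else (1::real)"
  have fin: "finite u" using D u finite_subset by blast
  have "(LINT x|cube_measure D. box_ind u x t) = (LINT x|cube_measure D. (\<Prod>j\<in>D. ?f j (x j)))"
    using D u fin by (simp add: box_ind_prod prod.If_cases Int_absorb1)
  also have "\<dots> = (\<Prod>j\<in>D. integral\<^sup>L unit_interval (?f j))"
    using D by (intro cube_integral_prod integrable_unit_interval[of _ 1]) auto
  also have "\<dots> = (\<Prod>j\<in>D. if j \<in> u then 1 - t j else 1)"
    using t U.prob_space by (intro prod.cong refl) (auto simp: integral_step unit_cubeD)
  also have "\<dots> = corner_volume u t"
    using D u by (simp add: corner_volume_def prod.If_cases Int_absorb1)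
  finally show ?thesis .
qed

section \<open>Error representation and duality\<close>

text \<open>The majorant \<open>1 + |g|^q\<close> is integrable because the measure is finite; for
  \<open>q = \<infinity>\<close> a constant serves.\<close>

lemma in_Lq_integrable:
  assumes q: "1 < q" and g: "in_Lq q (cube_measure u) g"
  shows "integrable (cube_measure u) g"
proof (cases q)
  case (real r)
  have [measurable]: "g \<in> borel_measurable (cube_measure u)"
    using g by (simp add: in_Lq_def)
  have "integrable (cube_measure u) (\<lambda>t. 1 + \<bar>g t\<bar> powr r)"
    using g real by (simp add: in_Lq_def)
  then show ?thesis
  proof (rule Bochner_Integration.integrable_bound)
    have "\<bar>g t\<bar> \<le> 1 + \<bar>g t\<bar> powr r" for t
    proof (cases "\<bar>g t\<bar> \<le> 1")
      case False
      then have "\<bar>g t\<bar> powr 1 \<le> \<bar>g t\<bar> powr r"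
        using q real by (intro powr_mono) auto
      then show ?thesis using False by simp
    qed (simp add: add_increasing2)
    then show "AE t in cube_measure u. norm (g t) \<le> norm (1 + \<bar>g t\<bar> powr r)"
      by (auto simp: abs_of_nonneg)
  qed measurable
next
  case PInf
  then have [measurable]: "g \<in> borel_measurable (cube_measure u)"
    and fin: "Linf_norm (cube_measure u) g < \<infinity>"
    using g by (auto simp: in_Lq_def)
  then obtain B where B: "Linf_norm (cube_measure u) g \<le> ereal B"
    by (metis ereal_less_PInfty less_ereal.simps(2) less_PInf_Ex_of_nat less_imp_le)
  have "AE t in cube_measure u. ereal \<bar>g t\<bar> \<le> ereal B"
    using esssup_AE[of "\<lambda>t. ereal \<bar>g t\<bar>" "cube_measure u"] B
    unfolding Linf_norm_def by (elim AE_mp) (intro AE_I2 impI, rule order_trans)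
  then show ?thesis
    by (intro C.integrable_const_bound[where B = B]) auto
qed (use q in auto)

lemma integrable_box_mult:
  fixes g :: "(nat \<Rightarrow> real) \<Rightarrow> real"
  assumes "finite u" "integrable (cube_measure u) g"
  shows "integrable (cube_measure u) (\<lambda>t. box_ind u x t * g t)"
proof (rule Bochner_Integration.integrable_bound[OF assms(2)])
  have [measurable]: "box_ind u x \<in> borel_measurable (cube_measure u)"
    by (rule box_ind_measurable) fact
  show "(\<lambda>t. box_ind u x t * g t) \<in> borel_measurable (cube_measure u)"
    using assms(2) by measurable
qed (auto simp: box_ind_def)

lemma integrable_corner_mult:
  fixes g :: "(nat \<Rightarrow> real) \<Rightarrow> real"
  assumes "integrable (cube_measure u) g"
  shows "integrable (cube_measure u) (\<lambda>t. corner_volume u t * g t)"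
proof (rule Bochner_Integration.integrable_bound[OF assms])
  show "AE t in cube_measure u. norm (corner_volume u t * g t) \<le> norm (g t)"
    using corner_volume_bounds by (intro AE_I2) (auto simp: abs_mult mult_left_le_one_le)
qed (use assms in measurable)

lemma integrable_pair:
  assumes fin: "finite u" "u \<subseteq> D" and g: "integrable (cube_measure u) g"
  shows "integrable (cube_measure D \<Otimes>\<^sub>M cube_measure u) (\<lambda>(x, t). box_ind u x t * g t :: real)"
proof -
  interpret P: pair_sigma_finite "cube_measure D" "cube_measure u" ..
  note [measurable] = box_ind_measurable_pair[OF fin]
  have [measurable]: "g \<in> borel_measurable (cube_measure u)"
    using g by auto
  have "integrable (cube_measure D \<Otimes>\<^sub>M cube_measure u) (\<lambda>z. g (snd z))"
    by (rule P.Fubini_integrable) (use g in \<open>auto intro!: borel_measurable_integrable\<close>)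
  then show ?thesis
  proof (rule Bochner_Integration.integrable_bound)
    show "(\<lambda>(x, t). box_ind u x t * g t) \<in> borel_measurable (cube_measure D \<Otimes>\<^sub>M cube_measure u)"
      by (simp add: case_prod_beta') measurable
  qed (auto simp: box_ind_def)
qed

text \<open>Fubini's theorem. It serves two purposes: with a mixed derivative for \<open>g\<close>
  it yields the formula for the integral of \<open>f\<close>, and with a function of the accumulated
  discrepancy for \<open>g\<close> it averages over a random node.\<close>

lemma integral_box_swap:
  assumes D: "finite D" "u \<subseteq> D" and g: "integrable (cube_measure u) g"
  shows "(LINT x|cube_measure D. (LINT t|cube_measure u. box_ind u x t * g t)) =
         (LINT t|cube_measure u. corner_volume u t * g t)"
    and "integrable (cube_measure D) (\<lambda>x. LINT t|cube_measure u. box_ind u x t * g t)"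
proof -
  interpret P: pair_sigma_finite "cube_measure D" "cube_measure u" ..
  have fin: "finite u" using D finite_subset by blast
  note int = integrable_pair[OF fin D(2) g]
  show "integrable (cube_measure D) (\<lambda>x. LINT t|cube_measure u. box_ind u x t * g t)"
    using P.integrable_fst'[OF int] by simp
  have "(LINT x|cube_measure D. (LINT t|cube_measure u. box_ind u x t * g t)) =
        (LINT t|cube_measure u. (LINT x|cube_measure D. box_ind u x t * g t))"
    by (rule P.Fubini_integral[OF int, symmetric])
  also have "\<dots> = (LINT t|cube_measure u. corner_volume u t * g t)"
    using D by (intro Bochner_Integration.integral_cong refl) (simp add: integral_box_ind)
  finally show "(LINT x|cube_measure D. (LINT t|cube_measure u. box_ind u x t * g t)) =
         (LINT t|cube_measure u. corner_volume u t * g t)" .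
qed

lemma has_mixed_derivs_box:
  assumes f: "has_mixed_derivs q d f g" and x: "x \<in> unit_cube {1..d}"
  shows "f x = (\<Sum>u\<in>Pow {1..d}. LINT t|cube_measure u. box_ind u x t * g u t)"
proof -
  have "f x = (\<Sum>u\<in>Pow {1..d}. set_lebesgue_integral (cube_measure u) (\<Pi>\<^sub>E j\<in>u. {0..x j}) (g u))"
    using f x by (simp add: has_mixed_derivs_def)
  also have "\<dots> = (\<Sum>u\<in>Pow {1..d}. LINT t|cube_measure u. box_ind u x t * g u t)"
    unfolding set_lebesgue_integral_def
    by (intro sum.cong refl Bochner_Integration.integral_cong) (auto simp: indicator_box)
  finally show ?thesis .
qed

lemma has_mixed_derivs_integrable:
  assumes "1 < q" "has_mixed_derivs q d f g" "u \<subseteq> {1..d}"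
  shows "integrable (cube_measure u) (g u)"
  using assms by (intro in_Lq_integrable[of q]) (auto simp: has_mixed_derivs_def)

lemma cube_integral_eq:
  assumes q: "1 < q" and f: "has_mixed_derivs q d f g"
  shows "cube_integral d f = (\<Sum>u\<in>Pow {1..d}. LINT t|cube_measure u. corner_volume u t * g u t)"
proof -
  have "cube_integral d f = (LINT x|cube_measure {1..d}.
          (\<Sum>u\<in>Pow {1..d}. LINT t|cube_measure u. box_ind u x t * g u t))"
    unfolding cube_integral_def
    by (intro Bochner_Integration.integral_cong refl has_mixed_derivs_box[OF f]) simp
  also have "\<dots> = (\<Sum>u\<in>Pow {1..d}. LINT x|cube_measure {1..d}. (LINT t|cube_measure u. box_ind u x t * g u t))"
    by (intro Bochner_Integration.integral_sum integral_box_swap(2) has_mixed_derivs_integrable[OF q f]) auto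
  also have "\<dots> = (\<Sum>u\<in>Pow {1..d}. LINT t|cube_measure u. corner_volume u t * g u t)"
    by (intro sum.cong refl integral_box_swap(1) has_mixed_derivs_integrable[OF q f]) auto
  finally show ?thesis .
qed

definition discrepancy ::
    "nat \<Rightarrow> (nat \<Rightarrow> real) \<Rightarrow> (nat \<Rightarrow> nat \<Rightarrow> real) \<Rightarrow> nat set \<Rightarrow> (nat \<Rightarrow> real) \<Rightarrow> real" where
  "discrepancy N a x u t = corner_volume u t - (\<Sum>k=1..N. a k * box_ind u (x k) t)"

lemma discrepancy_measurable [measurable]:
  assumes "finite u"
  shows "discrepancy N a x u \<in> borel_measurable (cube_measure u)"
proof -
  have [measurable]: "\<And>y. box_ind u y \<in> borel_measurable (cube_measure u)"
    using assms by (rule box_ind_measurable)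
  show ?thesis unfolding discrepancy_def by measurable
qed

lemma discrepancy_bound:
  assumes "t \<in> unit_cube u"
  shows "\<bar>discrepancy N a x u t\<bar> \<le> 1 + (\<Sum>k=1..N. \<bar>a k\<bar>)"
proof -
  have "\<bar>\<Sum>k=1..N. a k * box_ind u (x k) t\<bar> \<le> (\<Sum>k=1..N. \<bar>a k * box_ind u (x k) t\<bar>)"
    by (rule sum_abs)
  also have "\<dots> \<le> (\<Sum>k=1..N. \<bar>a k\<bar>)"
    by (intro sum_mono) (auto simp: box_ind_def)
  finally show ?thesis
    using corner_volume_bounds[OF assms] by (auto simp: discrepancy_def)
qed

lemma quadrature_error_eq:
  assumes q: "1 < q" and f: "has_mixed_derivs q d f g"
    and x: "\<And>k. k \<in> {1..N} \<Longrightarrow> x k \<in> unit_cube {1..d}"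
  shows "cube_integral d f - quadrature N a x f =
    (\<Sum>u\<in>Pow {1..d}. LINT t|cube_measure u. g u t * discrepancy N a x u t)"
proof -
  note int = has_mixed_derivs_integrable[OF q f]
  have fin: "u \<in> Pow {1..d} \<Longrightarrow> finite u" for u :: "nat set"
    using finite_subset by auto
  have "quadrature N a x f = (\<Sum>k=1..N. a k * (\<Sum>u\<in>Pow {1..d}. LINT t|cube_measure u. box_ind u (x k) t * g u t))"
    unfolding quadrature_def by (intro sum.cong refl) (simp add: has_mixed_derivs_box[OF f x])
  also have "\<dots> = (\<Sum>u\<in>Pow {1..d}. \<Sum>k=1..N. LINT t|cube_measure u. a k * (box_ind u (x k) t * g u t))"
    by (simp add: sum_distrib_left) (rule sum.swap)
  also have "\<dots> = (\<Sum>u\<in>Pow {1..d}. LINT t|cube_measure u. (\<Sum>k=1..N. a k * (box_ind u (x k) t * g u t)))"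
    using fin int
    by (intro sum.cong refl Bochner_Integration.integral_sum[symmetric] integrable_mult_right integrable_box_mult) auto
  finally have "cube_integral d f - quadrature N a x f = (\<Sum>u\<in>Pow {1..d}.
      (LINT t|cube_measure u. corner_volume u t * g u t) -
      (LINT t|cube_measure u. (\<Sum>k=1..N. a k * (box_ind u (x k) t * g u t))))"
    by (simp add: cube_integral_eq[OF q f] sum_subtractf)
  also have "\<dots> = (\<Sum>u\<in>Pow {1..d}. LINT t|cube_measure u. g u t * discrepancy N a x u t)"
  proof (intro sum.cong refl)
    fix u assume u: "u \<in> Pow {1..d}"
    have "(LINT t|cube_measure u. corner_volume u t * g u t) -
        (LINT t|cube_measure u. (\<Sum>k=1..N. a k * (box_ind u (x k) t * g u t))) =
        (LINT t|cube_measure u. corner_volume u t * g u t - (\<Sum>k=1..N. a k * (box_ind u (x k) t * g u t)))"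
      using u fin int
      by (intro Bochner_Integration.integral_diff[symmetric] integrable_corner_mult
            Bochner_Integration.integrable_sum integrable_mult_right integrable_box_mult) auto
    also have "\<dots> = (LINT t|cube_measure u. g u t * discrepancy N a x u t)"
      by (intro Bochner_Integration.integral_cong refl)
         (simp add: discrepancy_def algebra_simps sum_distrib_left)
    finally show "(LINT t|cube_measure u. corner_volume u t * g u t) -
        (LINT t|cube_measure u. (\<Sum>k=1..N. a k * (box_ind u (x k) t * g u t))) =
        (LINT t|cube_measure u. g u t * discrepancy N a x u t)" .
  qed
  finally show ?thesis .
qed

section \<open>Hoelder's inequality for the quadrature error\<close>

lemma conj_exponent_gt_1:
  fixes p q :: real
  assumes "1 < q" "1 / p + 1 / q = 1"
  shows "1 < p"
proof -
  have "1 / p = 1 - 1 / q" "0 < 1 / q" "1 / q < 1" using assms by auto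
  then have "0 < 1 / p" "1 / p < 1" by linarith+
  then show ?thesis by simp
qed

lemma conj_exponent_mult:
  fixes p q :: real
  assumes "1 < q" "1 / p + 1 / q = 1"
  shows "(p - 1) * q = p"
proof -
  have "p \<noteq> 0" "q \<noteq> 0" using assms by auto
  then show ?thesis using assms(2) by (simp add: field_simps)
qed

lemma mixed_derivs_unit_ball:
  assumes "f \<in> unit_ball q \<gamma> d"
  shows "has_mixed_derivs q d f (mixed_derivs q d f)"
proof -
  obtain g where "has_mixed_derivs q d f g"
    using assms by (auto simp: unit_ball_def sobolev_space_def)
  then show ?thesis
    unfolding mixed_derivs_def by (rule someI[of "has_mixed_derivs q d f"])
qed

lemma weight_prod_pos: "(\<And>j. j \<in> u \<Longrightarrow> 0 < \<gamma> j) \<Longrightarrow> 0 < weight_prod \<gamma> u"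
  by (auto simp: weight_prod_def intro: prod_pos)

text \<open>The \<open>p\<close>-th power of the norm dual to \<open>sobolev_norm\<close>, evaluated
  at the family \<open>D\<close>. Keeping the power makes it a plain sum of integrals, which later
  factors into one-dimensional ones.\<close>

definition disc_norm_pow ::
    "real \<Rightarrow> (nat \<Rightarrow> real) \<Rightarrow> nat \<Rightarrow> (nat set \<Rightarrow> (nat \<Rightarrow> real) \<Rightarrow> real) \<Rightarrow> real" where
  "disc_norm_pow p \<gamma> d D =
     (\<Sum>u\<in>Pow {1..d}. weight_prod \<gamma> u powr (p / 2) * (LINT t|cube_measure u. \<bar>D u t\<bar> powr p))"

lemma integrable_discrepancy_powr:
  assumes "finite u" "0 \<le> p"
  shows "integrable (cube_measure u) (\<lambda>t. \<bar>discrepancy N a x u t\<bar> powr p)"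
proof (rule integrable_cube)
  have [measurable]: "discrepancy N a x u \<in> borel_measurable (cube_measure u)"
    using assms by simp
  show "(\<lambda>t. \<bar>discrepancy N a x u t\<bar> powr p) \<in> borel_measurable (cube_measure u)"
    by measurable
  show "\<bar>\<bar>discrepancy N a x u t\<bar> powr p\<bar> \<le> (1 + (\<Sum>k=1..N. \<bar>a k\<bar>)) powr p" if "t \<in> unit_cube u" for t
    using discrepancy_bound[OF that] assms by (auto intro: powr_mono2)
qed

text \<open>The majorant \<open>S\<close> is an arbitrary positive number rather than the norm of the discrepancy, which
  avoids a case distinction when the latter vanishes.\<close>

lemma error_le_finite:
  assumes q: "1 < q" and conj: "1 / p + 1 / q = 1"
    and \<gamma>: "\<And>j. j \<in> {1..d} \<Longrightarrow> 0 < \<gamma> j"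
    and f: "f \<in> unit_ball (ereal q) \<gamma> d"
    and x: "\<And>k. k \<in> {1..N} \<Longrightarrow> x k \<in> unit_cube {1..d}"
    and S: "0 < S" "disc_norm_pow p \<gamma> d (discrepancy N a x) \<le> S powr p"
  shows "\<bar>cube_integral d f - quadrature N a x f\<bar> \<le> S"
proof -
  define g where "g = mixed_derivs (ereal q) d f"
  have g: "has_mixed_derivs (ereal q) d f g"
    using mixed_derivs_unit_ball[OF f] by (simp add: g_def)
  have p: "1 < p" using q conj by (rule conj_exponent_gt_1)
  define D where "D = discrepancy N a x"
  define W where "W = weight_prod \<gamma>"
  have W: "0 < W u" if "u \<in> Pow {1..d}" for u
    using that \<gamma> unfolding W_def by (intro weight_prod_pos) blast
  have fin: "finite u" if "u \<in> Pow {1..d}" for u :: "nat set"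
    using that finite_subset by auto
  let ?G = "\<lambda>u t. 1 / W u powr (q / 2) * \<bar>g u t\<bar> powr q"
  let ?H = "\<lambda>u t. W u powr (p / 2) * \<bar>D u t\<bar> powr p"
  have intG: "integrable (cube_measure u) (?G u)" if "u \<in> Pow {1..d}" for u
    using g that by (auto simp: has_mixed_derivs_def in_Lq_def)
  have intH: "integrable (cube_measure u) (?H u)" if "u \<in> Pow {1..d}" for u
    using integrable_discrepancy_powr[OF fin[OF that], of p N a x] p by (simp add: D_def)
  have sob: "(\<Sum>u\<in>Pow {1..d}. LINT t|cube_measure u. ?G u t) \<le> 1"
  proof -
    have "(\<Sum>u\<in>Pow {1..d}. 1 / W u powr (q / 2) * (LINT t|cube_measure u. \<bar>g u t\<bar> powr q)) powr (1 / q) \<le> 1"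
      using f by (simp add: unit_ball_def sobolev_norm_def g_def W_def)
    then have "(\<Sum>u\<in>Pow {1..d}. 1 / W u powr (q / 2) * (LINT t|cube_measure u. \<bar>g u t\<bar> powr q)) \<le> 1"
      using q by (smt (verit) gr_one_powr zero_less_divide_1_iff)
    then show ?thesis by simp
  qed
  have young: "\<bar>g u t * D u t\<bar> \<le> S * (?G u t / q + ?H u t / (p * S powr p))"
    if u: "u \<in> Pow {1..d}" for u t
  proof -
    \<comment> \<open>The weight enters the two arguments with opposite powers \<open>1/2\<close>
      and \<open>- 1/2\<close>: it cancels in the product \<open>A * B\<close>, while
      \<open>A powr p\<close> and \<open>B powr q\<close> carry exactly the weights of the dual norm
      and of the Sobolev norm.\<close>
    define A where "A = \<bar>D u t\<bar> * W u powr (1/2) / S"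
    define B where "B = \<bar>g u t\<bar> / W u powr (1/2)"
    have "A * B \<le> A powr p / p + B powr q / q"
      using p q conj S by (intro Youngs_inequality) (auto simp: A_def B_def)
    moreover have "A powr p = ?H u t / S powr p"
      using W[OF u] S by (simp add: A_def powr_divide powr_mult powr_powr)
    moreover have "B powr q = ?G u t"
      using W[OF u] by (simp add: B_def powr_divide powr_mult powr_powr)
    moreover have "\<bar>g u t * D u t\<bar> = S * (A * B)"
      using W[OF u] S by (simp add: A_def B_def abs_mult)
    ultimately have "\<bar>g u t * D u t\<bar> \<le> S * (?H u t / S powr p / p + ?G u t / q)"
      using S by (metis mult_left_mono less_imp_le)
    also have "\<dots> = S * (?G u t / q + ?H u t / (p * S powr p))"
      by (simp add: mult.commute add.commute)
    finally show ?thesis .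
  qed
  have "\<bar>cube_integral d f - quadrature N a x f\<bar> =
      \<bar>\<Sum>u\<in>Pow {1..d}. LINT t|cube_measure u. g u t * D u t\<bar>"
    using q by (subst quadrature_error_eq[OF _ g x]) (auto simp: D_def)
  also have "\<dots> \<le> (\<Sum>u\<in>Pow {1..d}. \<bar>LINT t|cube_measure u. g u t * D u t\<bar>)"
    by (rule sum_abs)
  also have "\<dots> \<le> (\<Sum>u\<in>Pow {1..d}. LINT t|cube_measure u. S * (?G u t / q + ?H u t / (p * S powr p)))"
  proof (rule sum_mono)
    fix u assume u: "u \<in> Pow {1..d}"
    have int: "integrable (cube_measure u) (\<lambda>t. S * (?G u t / q + ?H u t / (p * S powr p)))"
      by (intro intG[OF u] intH[OF u] integrable_mult_right Bochner_Integration.integrable_add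
          integrable_divide_zero impI)
    have "\<bar>LINT t|cube_measure u. g u t * D u t\<bar> \<le> (LINT t|cube_measure u. \<bar>g u t * D u t\<bar>)"
      by (rule integral_abs_bound)
    also have "\<dots> \<le> (LINT t|cube_measure u. S * (?G u t / q + ?H u t / (p * S powr p)))"
      using S p q by (intro integral_mono'[OF int young[OF u]] mult_nonneg_nonneg add_nonneg_nonneg
          divide_nonneg_nonneg) auto
    finally show "\<bar>LINT t|cube_measure u. g u t * D u t\<bar> \<le> \<dots>" .
  qed
  also have "\<dots> = S * ((\<Sum>u\<in>Pow {1..d}. LINT t|cube_measure u. ?G u t) / q
      + disc_norm_pow p \<gamma> d D / (p * S powr p))"
  proof -
    have each: "(LINT t|cube_measure u. S * (?G u t / q + ?H u t / (p * S powr p))) =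
        S * ((LINT t|cube_measure u. ?G u t) / q + (LINT t|cube_measure u. ?H u t) / (p * S powr p))"
      if u: "u \<in> Pow {1..d}" for u
    proof -
      have "integrable (cube_measure u) (\<lambda>t. ?G u t / q)"
          "integrable (cube_measure u) (\<lambda>t. ?H u t / (p * S powr p))"
        by (intro intG[OF u] intH[OF u] integrable_divide_zero impI)+
      then show ?thesis
        by (simp only: integral_mult_right_zero Bochner_Integration.integral_add integral_divide_zero)
    qed
    have disc: "disc_norm_pow p \<gamma> d D = (\<Sum>u\<in>Pow {1..d}. LINT t|cube_measure u. ?H u t)"
      by (simp add: disc_norm_pow_def W_def)
    show ?thesis
      unfolding disc sum_divide_distrib sum.distrib[symmetric] sum_distrib_left
      by (intro sum.cong refl each)
  qed
  also have "\<dots> \<le> S * (1 / q + 1 / p)"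
  proof -
    have "disc_norm_pow p \<gamma> d D / (p * S powr p) \<le> 1 / p"
      using S p by (simp add: D_def field_simps)
    moreover have "(\<Sum>u\<in>Pow {1..d}. LINT t|cube_measure u. ?G u t) / q \<le> 1 / q"
      using sob q by (simp only: divide_right_mono)
    ultimately show ?thesis using S by (intro mult_left_mono add_mono) auto
  qed
  finally show ?thesis using conj by (simp add: add.commute)
qed

text \<open>For \<open>q = \<infinity>\<close> the constraint is pointwise: almost everywhere
  \<open>|g u|\<close> is at most the square root of the weight of \<open>u\<close>. Pairing with
  the discrepancy then gives a weighted sum of \<open>L_1\<close> norms without Young's
  inequality.\<close>

lemma error_le_infinity:
  assumes \<gamma>: "\<And>j. j \<in> {1..d} \<Longrightarrow> 0 < \<gamma> j"
    and f: "f \<in> unit_ball \<infinity> \<gamma> d"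
    and x: "\<And>k. k \<in> {1..N} \<Longrightarrow> x k \<in> unit_cube {1..d}"
  shows "\<bar>cube_integral d f - quadrature N a x f\<bar> \<le> disc_norm_pow 1 \<gamma> d (discrepancy N a x)"
proof -
  define g where "g = mixed_derivs \<infinity> d f"
  have g: "has_mixed_derivs \<infinity> d f g"
    using mixed_derivs_unit_ball[OF f] by (simp add: g_def)
  define D where "D = discrepancy N a x"
  define W where "W = weight_prod \<gamma>"
  have W: "0 < W u" if "u \<in> Pow {1..d}" for u
    using that \<gamma> unfolding W_def by (intro weight_prod_pos) blast
  have fin: "finite u" if "u \<in> Pow {1..d}" for u :: "nat set"
    using that finite_subset by auto
  have gb: "AE t in cube_measure u. \<bar>g u t\<bar> \<le> W u powr (1/2)" if u: "u \<in> Pow {1..d}" for u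
  proof -
    let ?L = "Linf_norm (cube_measure u) (g u)"
    have "W u powr (- (1/2)) * real_of_ereal ?L \<le>
        Max ((\<lambda>u. W u powr (- (1/2)) * real_of_ereal (Linf_norm (cube_measure u) (g u))) ` Pow {1..d})"
      using u by (intro Max_ge) auto
    also have "\<dots> \<le> 1"
      using f by (simp add: unit_ball_def sobolev_norm_def g_def W_def)
    finally have L: "real_of_ereal ?L \<le> W u powr (1/2)"
      using W[OF u] by (simp add: powr_minus field_simps)
    have ae: "AE t in cube_measure u. ereal \<bar>g u t\<bar> \<le> ?L"
      unfolding Linf_norm_def by (rule esssup_AE)
    \<comment> \<open>Finiteness matters: \<open>real_of_ereal\<close> sends \<infinity> to 0, so
      \<open>L\<close> alone would not exclude an infinite essential supremum.\<close>
    have "?L < \<infinity>" using g u by (auto simp: has_mixed_derivs_def in_Lq_def)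
    from ae show ?thesis
    proof (rule AE_mp, intro AE_I2 impI)
      fix t assume "ereal \<bar>g u t\<bar> \<le> ?L"
      then show "\<bar>g u t\<bar> \<le> W u powr (1/2)"
        using L \<open>?L < \<infinity>\<close> by (cases ?L) auto
    qed
  qed
  have "\<bar>cube_integral d f - quadrature N a x f\<bar> =
      \<bar>\<Sum>u\<in>Pow {1..d}. LINT t|cube_measure u. g u t * D u t\<bar>"
    by (subst quadrature_error_eq[OF _ g x]) (auto simp: D_def)
  also have "\<dots> \<le> (\<Sum>u\<in>Pow {1..d}. \<bar>LINT t|cube_measure u. g u t * D u t\<bar>)"
    by (rule sum_abs)
  also have "\<dots> \<le> (\<Sum>u\<in>Pow {1..d}. LINT t|cube_measure u. W u powr (1/2) * \<bar>D u t\<bar>)"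
  proof (rule sum_mono)
    fix u assume u: "u \<in> Pow {1..d}"
    have int: "integrable (cube_measure u) (\<lambda>t. W u powr (1/2) * \<bar>D u t\<bar>)"
      using integrable_discrepancy_powr[OF fin[OF u], of 1 N a x] by (simp add: D_def)
    have "\<bar>LINT t|cube_measure u. g u t * D u t\<bar> \<le> (LINT t|cube_measure u. \<bar>g u t * D u t\<bar>)"
      by (rule integral_abs_bound)
    also have "\<dots> \<le> (LINT t|cube_measure u. W u powr (1/2) * \<bar>D u t\<bar>)"
      using gb[OF u] by (intro integral_mono_AE'[OF int])
        (auto simp: abs_mult intro!: mult_right_mono elim!: AE_mp)
    finally show "\<bar>LINT t|cube_measure u. g u t * D u t\<bar> \<le> \<dots>" .
  qed
  finally show ?thesis
    by (simp add: disc_norm_pow_def D_def W_def)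
qed

section \<open>Uniqueness of mixed derivatives\<close>

text \<open>Used with \<open>c = 0\<close> for the uniqueness of mixed derivatives and with
  \<open>c = 1\<close> to find nodes in the half-open cube.\<close>

lemma AE_cube_component_neq:
  assumes "j \<in> u"
  shows "AE t in cube_measure u. t j \<noteq> c"
proof -
  have "AE s in unit_interval. s \<noteq> c"
    using AE_lborel_singleton[of c] by (subst AE_restrict_space_iff) auto
  then show ?thesis
    unfolding cube_measure_def
    using assms by (intro AE_PiM_component prob_space_unit_interval)
qed

text \<open>An intersection-stable generator of the sigma-algebra of the cube. It contains the whole
  cube, as the box whose corner has all coordinates 1.\<close>

definition boxes :: "nat set \<Rightarrow> (nat \<Rightarrow> real) set set" where
  "boxes u = {{t \<in> unit_cube u. \<forall>j\<in>u. t j \<le> x j} |x. x \<in> unit_cube u}"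

lemma Int_stable_boxes: "Int_stable (boxes u)"
proof (rule Int_stableI)
  fix A B assume "A \<in> boxes u" "B \<in> boxes u"
  then obtain x y where xy: "x \<in> unit_cube u" "y \<in> unit_cube u"
      and A: "A = {t \<in> unit_cube u. \<forall>j\<in>u. t j \<le> x j}" and B: "B = {t \<in> unit_cube u. \<forall>j\<in>u. t j \<le> y j}"
    by (auto simp: boxes_def)
  define z where "z = restrict (\<lambda>j. min (x j) (y j)) u"
  have "z \<in> unit_cube u"
    using xy by (auto simp: z_def unit_cube_def PiE_iff min_def)
  moreover have "A \<inter> B = {t \<in> unit_cube u. \<forall>j\<in>u. t j \<le> z j}"
    by (auto simp: A B z_def)
  ultimately show "A \<inter> B \<in> boxes u"
    by (auto simp: boxes_def)
qed

text \<open>A sublevel set of one coordinate is itself a box, with corner entry \<open>a\<close>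
  there and 1 elsewhere, when \<open>0 \<le> a < 1\<close>; otherwise it is empty or the whole cube.
  So all coordinate maps are measurable for the sigma-algebra generated by the boxes.\<close>

lemma sets_cube_boxes: "sets (cube_measure u) \<subseteq> sigma_sets (unit_cube u) (boxes u)"
proof -
  define N where "N = sigma (unit_cube u) (boxes u)"
  have sub: "boxes u \<subseteq> Pow (unit_cube u)"
    by (auto simp: boxes_def)
  have sp: "space N = unit_cube u"
    by (simp add: N_def space_measure_of_conv)
  have sN: "sets N = sigma_sets (unit_cube u) (boxes u)"
    unfolding N_def using sub by (rule sets_measure_of)
  have comp: "(\<lambda>t. t i) \<in> borel_measurable N" if i: "i \<in> u" for i
  proof (rule borel_measurable_iff_le[THEN iffD2], rule allI)
    fix a :: real
    consider "a < 0" | "1 \<le> a" | "0 \<le> a" "a < 1" by linarith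
    then show "{t \<in> space N. t i \<le> a} \<in> sets N"
    proof cases
      case 1
      have "{t \<in> space N. t i \<le> a} = {}"
        using 1 i unit_cubeD[of _ u i] by (fastforce simp: sp)
      then show ?thesis by (simp only: sets.empty_sets)
    next
      case 2
      have "{t \<in> space N. t i \<le> a} = space N"
        using 2 i unit_cubeD[of _ u i] by (fastforce simp: sp)
      then show ?thesis by simp
    next
      case 3
      define x where "x = restrict (\<lambda>j. if j = i then a else 1) u"
      have "x \<in> unit_cube u"
        using 3 by (auto simp: x_def unit_cube_def PiE_iff)
      moreover have "{t \<in> space N. t i \<le> a} = {t \<in> unit_cube u. \<forall>j\<in>u. t j \<le> x j}"
        using i unit_cubeD[of _ u] by (auto simp: sp x_def)
      ultimately have "{t \<in> space N. t i \<le> a} \<in> boxes u"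
        by (auto simp: boxes_def)
      then show ?thesis by (auto simp: sN)
    qed
  qed
  have "sets (cube_measure u) \<subseteq> sets N"
    unfolding cube_measure_def
  proof (rule sets_PiM_in_sets)
    show "space N = (\<Pi>\<^sub>E i\<in>u. space unit_interval)"
      by (simp add: sp unit_cube_def)
    fix i A assume i: "i \<in> u" and A: "A \<in> sets unit_interval"
    then have "A \<in> sets borel"
      by (subst (asm) sets_restrict_space_iff) auto
    with comp[OF i] have "(\<lambda>t. t i) -` A \<inter> space N \<in> sets N"
      by (rule measurable_sets)
    moreover have "(\<lambda>t. t i) -` A \<inter> space N = {x \<in> space N. x i \<in> A}"
      by auto
    ultimately show "{x \<in> space N. x i \<in> A} \<in> sets N"
      by simp
  qed
  then show ?thesis by (simp add: sN)
qed

text \<open>Dynkin's argument: the sets over which \<open>h\<close> integrates to 0 are closed under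
  complements and countable disjoint unions, and they contain the boxes, hence every measurable
  set.\<close>

lemma AE_eq_0_if_integral_boxes:
  fixes h :: "(nat \<Rightarrow> real) \<Rightarrow> real"
  assumes int: "integrable (cube_measure u) h" and u: "finite u"
    and zero: "\<And>x. x \<in> unit_cube u \<Longrightarrow> (LINT t|cube_measure u. box_ind u x t * h t) = 0"
  shows "AE t in cube_measure u. h t = 0"
proof -
  let ?M = "cube_measure u"
  have boxes_sets: "boxes u \<subseteq> sets ?M"
  proof
    fix A assume "A \<in> boxes u"
    then obtain x where "A = {t \<in> unit_cube u. \<forall>j\<in>u. t j \<le> x j}"
      by (auto simp: boxes_def)
    then have A: "A = {t \<in> space ?M. box_ind u x t = 1}"
      by (auto simp: box_ind_def)
    have [measurable]: "box_ind u x \<in> borel_measurable ?M"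
      using u by (rule box_ind_measurable)
    show "A \<in> sets ?M" unfolding A by measurable
  qed
  have sigma: "sigma_sets (unit_cube u) (boxes u) \<subseteq> sets ?M"
    using sets.sigma_sets_subset[OF boxes_sets] by simp
  have zero': "(LINT t:A|?M. h t) = 0" if A: "A \<in> sets ?M" for A
  proof -
    have "A \<in> sigma_sets (unit_cube u) (boxes u)"
      using A sets_cube_boxes by auto
    moreover have "boxes u \<subseteq> Pow (unit_cube u)"
      by (auto simp: boxes_def)
    moreover note Int_stable_boxes[of u]
    ultimately have "Int_stable (boxes u)" "boxes u \<subseteq> Pow (unit_cube u)"
        "A \<in> sigma_sets (unit_cube u) (boxes u)"
      by auto
    then show ?thesis
    proof (induction A rule: sigma_sets_induct_disjoint)
      case (basic A)
      then obtain x where x: "x \<in> unit_cube u" and A: "A = {t \<in> unit_cube u. \<forall>j\<in>u. t j \<le> x j}"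
        by (auto simp: boxes_def)
      have "(LINT t:A|?M. h t) = (LINT t|?M. box_ind u x t * h t)"
        unfolding set_lebesgue_integral_def
        by (intro Bochner_Integration.integral_cong refl) (auto simp: A box_ind_def)
      then show ?case using zero[OF x] by simp
    next
      case empty
      then show ?case by (simp add: set_lebesgue_integral_def)
    next
      case (compl A)
      have [measurable]: "A \<in> sets ?M" using compl sigma by auto
      define e where "e = restrict (\<lambda>_. 1::real) u"
      have "e \<in> unit_cube u" by (auto simp: e_def unit_cube_def)
      have "(LINT t|?M. h t) = (LINT t|?M. box_ind u e t * h t)"
        using unit_cubeD[of _ u] by (intro Bochner_Integration.integral_cong refl) (auto simp: box_ind_def e_def)
      then have tot: "(LINT t|?M. h t) = 0"
        using zero[OF \<open>e \<in> unit_cube u\<close>] by simp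
      have "(LINT t:unit_cube u - A|?M. h t) = (LINT t|?M. h t - indicator A t * h t)"
        unfolding set_lebesgue_integral_def
        by (intro Bochner_Integration.integral_cong refl) (auto simp: indicator_def)
      also have "\<dots> = (LINT t|?M. h t) - (LINT t|?M. indicator A t * h t)"
        using integrable_mult_indicator[OF _ int, of A]
        by (intro Bochner_Integration.integral_diff int) auto
      also have "\<dots> = 0"
        using compl tot by (simp add: set_lebesgue_integral_def)
      finally show ?case by simp
    next
      case (union A)
      have A: "A i \<in> sets ?M" for i using union sigma by auto
      have "(LINT t:(\<Union>i. A i)|?M. h t) = (\<Sum>i. (LINT t:(A i)|?M. h t))"
        using union(1) A integrable_mult_indicator[OF sets.countable_UN[where A = A and X = UNIV] int]
        by (intro lebesgue_integral_countable_add) (auto simp: disjoint_family_on_def set_integrable_def)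
      also have "\<dots> = 0" using union by (auto simp: image_subset_iff)
      finally show ?case .
    qed
  qed
  show ?thesis
    by (rule density_unique_real[OF int]) (auto simp: zero' set_lebesgue_integral_def[of _ _ "\<lambda>_. 0"])
qed

text \<open>Evaluating at points that vanish outside \<open>u\<close> isolates the terms indexed by subsets of \<open>u\<close>,
  so the coefficient functions can be eliminated by induction on \<open>u\<close>.\<close>

lemma box_expansion_unique:
  fixes h :: "nat set \<Rightarrow> (nat \<Rightarrow> real) \<Rightarrow> real"
  assumes D: "finite D" and int: "\<And>u. u \<subseteq> D \<Longrightarrow> integrable (cube_measure u) (h u)"
    and zero: "\<And>x. x \<in> unit_cube D \<Longrightarrow> (\<Sum>u\<in>Pow D. LINT t|cube_measure u. box_ind u x t * h u t) = 0"
    and u: "u \<subseteq> D"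
  shows "AE t in cube_measure u. h u t = 0"
proof -
  have "finite u" using D u finite_subset by blast
  then show ?thesis using u
  proof (induction u rule: finite_psubset_induct)
    case (psubset u)
    show ?case
    proof (rule AE_eq_0_if_integral_boxes)
      fix x assume x: "x \<in> unit_cube u"
      \<comment> \<open>Extends \<open>x\<close> by 0 inside \<open>D\<close>; the value
        \<open>undefined\<close> outside \<open>D\<close> keeps \<open>y\<close>
        extensional.\<close>
      define y where "y = (\<lambda>j. if j \<in> D then if j \<in> u then x j else 0 else undefined)"
      have y: "y \<in> unit_cube D"
        using x psubset.prems by (auto simp: y_def unit_cube_def PiE_iff extensional_def)
      have other: "(LINT t|cube_measure v. box_ind v y t * h v t) = 0"
        if v: "v \<in> Pow D - {u}" for v
      proof (cases "v \<subseteq> u")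
        case True
        with v have "AE t in cube_measure v. h v t = 0"
          using psubset.IH[of v] by auto
        then have "AE t in cube_measure v. box_ind v y t * h v t = 0"
          by eventually_elim simp
        then show ?thesis by (rule integral_eq_zero_AE)
      next
        case False
        then obtain j where j: "j \<in> v" "j \<notin> u" by auto
        then have yj: "y j = 0" using v by (auto simp: y_def)
        \<comment> \<open>Since \<open>y j = 0\<close>, the box in direction \<open>j\<close> is
          degenerate and lies in the null set of points with \<open>t j = 0\<close>.\<close>
        have "AE t in cube_measure v. box_ind v y t * h v t = 0"
          using AE_cube_component_neq[OF j(1), of 0] AE_space
        proof eventually_elim
          case (elim t)
          then have "\<not> t j \<le> y j"
            using unit_cubeD[of t v j] j yj by auto
          then show ?case using j by (auto simp: box_ind_def)
        qed
        then show ?thesis by (rule integral_eq_zero_AE)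
      qed
      have "(\<Sum>v\<in>Pow D. LINT t|cube_measure v. box_ind v y t * h v t) =
            (LINT t|cube_measure u. box_ind u y t * h u t)"
        using D psubset.prems other by (subst sum.remove[of _ u]) auto
      also have "\<dots> = (LINT t|cube_measure u. box_ind u x t * h u t)"
        using psubset.prems by (intro Bochner_Integration.integral_cong refl) (auto simp: box_ind_def y_def)
      finally show "(LINT t|cube_measure u. box_ind u x t * h u t) = 0"
        using zero[OF y] by simp
    qed (use psubset int in auto)
  qed
qed

lemma mixed_derivs_unique:
  assumes q: "1 < q" and g: "has_mixed_derivs q d f g" and g': "has_mixed_derivs q d f g'"
    and u: "u \<subseteq> {1..d}"
  shows "AE t in cube_measure u. g u t = g' u t"
proof -
  note int = has_mixed_derivs_integrable[OF q g] has_mixed_derivs_integrable[OF q g']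
  have "AE t in cube_measure u. g u t - g' u t = 0"
  proof (rule box_expansion_unique[where h = "\<lambda>u t. g u t - g' u t", OF _ _ _ u])
    fix x assume x: "x \<in> unit_cube {1..d}"
    have "(LINT t|cube_measure v. box_ind v x t * (g v t - g' v t)) =
        (LINT t|cube_measure v. box_ind v x t * g v t) - (LINT t|cube_measure v. box_ind v x t * g' v t)"
      if "v \<in> Pow {1..d}" for v
      using that int finite_subset[of v "{1..d}"]
      by (subst Bochner_Integration.integral_diff[symmetric])
         (auto intro!: integrable_box_mult simp: right_diff_distrib)
    then have "(\<Sum>v\<in>Pow {1..d}. LINT t|cube_measure v. box_ind v x t * (g v t - g' v t)) =
        (\<Sum>v\<in>Pow {1..d}. (LINT t|cube_measure v. box_ind v x t * g v t) -
          (LINT t|cube_measure v. box_ind v x t * g' v t))"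
      by (intro sum.cong refl)
    then show "(\<Sum>v\<in>Pow {1..d}. LINT t|cube_measure v. box_ind v x t * (g v t - g' v t)) = 0"
      using has_mixed_derivs_box[OF g x] has_mixed_derivs_box[OF g' x]
      by (simp add: sum_subtractf)
  qed (use int in auto)
  then show ?thesis by simp
qed

text \<open>The norm refers to the representatives picked by \<open>SOME\<close>. Uniqueness up to
  null sets lets any explicitly known family of mixed derivatives certify membership.\<close>

lemma unit_ballI_finite:
  assumes q: "1 < q" and g: "has_mixed_derivs (ereal q) d f g"
    and le: "(\<Sum>u\<in>Pow {1..d}. 1 / weight_prod \<gamma> u powr (q / 2) * (LINT t|cube_measure u. \<bar>g u t\<bar> powr q)) \<le> 1"
  shows "f \<in> unit_ball (ereal q) \<gamma> d"
proof -
  define g' where "g' = mixed_derivs (ereal q) d f"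
  have g': "has_mixed_derivs (ereal q) d f g'"
    unfolding g'_def mixed_derivs_def using g by (rule someI[of "has_mixed_derivs (ereal q) d f"])
  have "(LINT t|cube_measure u. \<bar>g' u t\<bar> powr q) = (LINT t|cube_measure u. \<bar>g u t\<bar> powr q)"
    if u: "u \<subseteq> {1..d}" for u
  proof (rule integral_cong_AE)
    show "AE t in cube_measure u. \<bar>g' u t\<bar> powr q = \<bar>g u t\<bar> powr q"
      using mixed_derivs_unique[OF _ g' g u] q by auto
    have [measurable]: "g u \<in> borel_measurable (cube_measure u)" "g' u \<in> borel_measurable (cube_measure u)"
      using g g' u by (auto simp: has_mixed_derivs_def in_Lq_def)
    show "(\<lambda>t. \<bar>g' u t\<bar> powr q) \<in> borel_measurable (cube_measure u)"
      "(\<lambda>t. \<bar>g u t\<bar> powr q) \<in> borel_measurable (cube_measure u)" by measurable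
  qed
  then have "sobolev_norm (ereal q) \<gamma> d f =
      (\<Sum>u\<in>Pow {1..d}. 1 / weight_prod \<gamma> u powr (q / 2) * (LINT t|cube_measure u. \<bar>g u t\<bar> powr q)) powr (1 / q)"
    using q unfolding sobolev_norm_def g'_def[symmetric]
    by (auto intro!: sum.cong arg_cong[where f = "\<lambda>s. s powr (1 / q)"])
  also have "\<dots> \<le> 1"
    using le q by (intro powr_le1) (auto simp: abs_of_nonneg sum_nonneg)
  finally show ?thesis
    using g by (auto simp: unit_ball_def sobolev_space_def)
qed

lemma unit_ballI_infinity:
  assumes g: "has_mixed_derivs \<infinity> d f g"
    and le: "\<And>u. u \<subseteq> {1..d} \<Longrightarrow> weight_prod \<gamma> u powr (- (1/2)) * real_of_ereal (Linf_norm (cube_measure u) (g u)) \<le> 1"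
  shows "f \<in> unit_ball \<infinity> \<gamma> d"
proof -
  define g' where "g' = mixed_derivs \<infinity> d f"
  have g': "has_mixed_derivs \<infinity> d f g'"
    unfolding g'_def mixed_derivs_def using g by (rule someI[of "has_mixed_derivs \<infinity> d f"])
  have "Linf_norm (cube_measure u) (g' u) = Linf_norm (cube_measure u) (g u)"
    if u: "u \<subseteq> {1..d}" for u
    unfolding Linf_norm_def
  proof (rule esssup_AE_cong)
    show "AE t in cube_measure u. ereal \<bar>g' u t\<bar> = ereal \<bar>g u t\<bar>"
      using mixed_derivs_unique[OF _ g' g u] by auto
    have [measurable]: "g u \<in> borel_measurable (cube_measure u)" "g' u \<in> borel_measurable (cube_measure u)"
      using g g' u by (auto simp: has_mixed_derivs_def in_Lq_def)
    show "(\<lambda>t. ereal \<bar>g' u t\<bar>) \<in> borel_measurable (cube_measure u)"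
      "(\<lambda>t. ereal \<bar>g u t\<bar>) \<in> borel_measurable (cube_measure u)" by measurable
  qed
  then have "sobolev_norm \<infinity> \<gamma> d f \<le> 1"
    using le by (auto simp: sobolev_norm_def g'_def[symmetric] intro!: Max.boundedI)
  then show ?thesis
    using g by (auto simp: unit_ball_def sobolev_space_def)
qed

section \<open>Tensor product test functions\<close>

text \<open>Bundles the finite conjugate exponents with the pair of \<infinity> and 1, so that the
  upper bound and its consequences are derived once for both.\<close>

definition conj_exponents :: "ereal \<Rightarrow> real \<Rightarrow> bool" where
  "conj_exponents q p \<longleftrightarrow> (q = \<infinity> \<and> p = 1) \<or> (\<exists>r. q = ereal r \<and> 1 < r \<and> 1 / p + 1 / r = 1)"

lemma conj_exponents_bounds:
  assumes "conj_exponents q p"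
  shows "1 < q" "1 \<le> p"
proof -
  show "1 < q" using assms by (auto simp: conj_exponents_def)
  show "1 \<le> p"
    using assms unfolding conj_exponents_def
  proof
    assume "\<exists>r. q = ereal r \<and> 1 < r \<and> 1 / p + 1 / r = 1"
    then show ?thesis
      using conj_exponent_gt_1[of _ p] by (auto intro: less_imp_le)
  qed auto
qed

lemma error_le:
  assumes qp: "conj_exponents q p"
    and \<gamma>: "\<And>j. j \<in> {1..d} \<Longrightarrow> 0 < \<gamma> j"
    and f: "f \<in> unit_ball q \<gamma> d"
    and x: "\<And>k. k \<in> {1..N} \<Longrightarrow> x k \<in> unit_cube {1..d}"
    and S: "0 < S" "disc_norm_pow p \<gamma> d (discrepancy N a x) \<le> S powr p"
  shows "\<bar>cube_integral d f - quadrature N a x f\<bar> \<le> S"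
  using qp unfolding conj_exponents_def
proof
  assume "q = \<infinity> \<and> p = 1"
  then show ?thesis
    using error_le_infinity[where f = f and x = x and a = a and N = N, OF \<gamma> _ x] f S by fastforce
next
  assume "\<exists>r. q = ereal r \<and> 1 < r \<and> 1 / p + 1 / r = 1"
  then show ?thesis
    using error_le_finite[OF _ _ \<gamma> _ x S] f by auto
qed

text \<open>For \<open>c = 1\<close> every factor is a one-variable function with value 1 at 0 and
  derivative \<open>w j * \<phi> j\<close>. Multiplying out over subsets shows that the mixed
  derivatives are the products \<open>tensor_deriv\<close>, so norm, integral and point values all
  reduce to one-dimensional integrals.\<close>

definition tensor_fun ::
    "nat \<Rightarrow> real \<Rightarrow> (nat \<Rightarrow> real) \<Rightarrow> (nat \<Rightarrow> real \<Rightarrow> real) \<Rightarrow> (nat \<Rightarrow> real) \<Rightarrow> real" where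
  "tensor_fun d c w \<phi> x =
     c * (\<Prod>j=1..d. 1 + w j * (LINT s|unit_interval. (if s \<le> x j then 1 else 0) * \<phi> j s))"

definition tensor_deriv ::
    "real \<Rightarrow> (nat \<Rightarrow> real) \<Rightarrow> (nat \<Rightarrow> real \<Rightarrow> real) \<Rightarrow> nat set \<Rightarrow> (nat \<Rightarrow> real) \<Rightarrow> real" where
  "tensor_deriv c w \<phi> u t = c * (\<Prod>j\<in>u. w j * \<phi> j (t j))"

context
  fixes w :: "nat \<Rightarrow> real" and \<phi> :: "nat \<Rightarrow> real \<Rightarrow> real" and c :: real and d :: nat
  assumes \<phi>_meas [measurable]: "\<And>j. \<phi> j \<in> borel_measurable borel"
    and \<phi>_bounds: "\<And>j t. 0 \<le> t \<Longrightarrow> t \<le> 1 \<Longrightarrow> 0 \<le> \<phi> j t \<and> \<phi> j t \<le> 1"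
    and w_nonneg: "\<And>j. j \<in> {1..d} \<Longrightarrow> 0 \<le> w j"
begin

lemma tensor_deriv_measurable [measurable]:
  assumes "u \<subseteq> {1..d}"
  shows "tensor_deriv c w \<phi> u \<in> borel_measurable (cube_measure u)"
  unfolding tensor_deriv_def
  by (intro borel_measurable_times borel_measurable_prod borel_measurable_const
      measurable_compose[OF component_measurable \<phi>_meas]) auto

lemma tensor_deriv_bound:
  assumes "u \<subseteq> {1..d}" "t \<in> unit_cube u"
  shows "\<bar>tensor_deriv c w \<phi> u t\<bar> \<le> \<bar>c\<bar> * (\<Prod>j\<in>u. \<bar>w j\<bar>)"
  unfolding tensor_deriv_def abs_mult abs_prod
  using assms \<phi>_bounds unit_cubeD[of t u]
  by (intro mult_left_mono prod_mono) (auto intro!: mult_left_le)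

lemma in_Lq_tensor_deriv:
  assumes "1 < q" "u \<subseteq> {1..d}"
  shows "in_Lq q (cube_measure u) (tensor_deriv c w \<phi> u)"
proof -
  have [measurable]: "tensor_deriv c w \<phi> u \<in> borel_measurable (cube_measure u)"
    using assms by measurable
  let ?B = "\<bar>c\<bar> * (\<Prod>j\<in>u. \<bar>w j\<bar>)"
  have "Linf_norm (cube_measure u) (tensor_deriv c w \<phi> u) \<le> ereal ?B"
    unfolding Linf_norm_def
    using tensor_deriv_bound[OF assms(2)] by (intro esssup_I AE_I2) auto
  then have "Linf_norm (cube_measure u) (tensor_deriv c w \<phi> u) < \<infinity>"
    by (rule le_less_trans) simp
  moreover have q0: "0 \<le> real_of_ereal q"
    using assms(1) by (cases q) auto
  moreover have "integrable (cube_measure u) (\<lambda>t. \<bar>tensor_deriv c w \<phi> u t\<bar> powr real_of_ereal q)"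
    using tensor_deriv_bound[OF assms(2)] q0
    by (intro integrable_cube[of _ _ "?B powr real_of_ereal q"])
       (auto intro!: powr_mono2)
  ultimately show ?thesis
    by (simp add: in_Lq_def)
qed

lemma integrable_factor:
  assumes "\<And>s. s \<in> {0..1} \<Longrightarrow> \<bar>b s\<bar> \<le> 1" "b \<in> borel_measurable borel"
  shows "integrable unit_interval (\<lambda>s. b s * \<phi> j s)"
  using assms \<phi>_bounds
  by (intro integrable_unit_interval[of _ 1]) (auto simp: abs_mult intro!: mult_le_one)

lemma integral_tensor_deriv:
  assumes "u \<subseteq> {1..d}" "\<And>j s. s \<in> {0..1} \<Longrightarrow> \<bar>b j s\<bar> \<le> 1" "\<And>j. b j \<in> borel_measurable borel"
  shows "(LINT t|cube_measure u. (\<Prod>j\<in>u. b j (t j)) * tensor_deriv c w \<phi> u t) =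
    c * (\<Prod>j\<in>u. w j * (LINT s|unit_interval. b j s * \<phi> j s))"
proof -
  have "(LINT t|cube_measure u. (\<Prod>j\<in>u. b j (t j)) * tensor_deriv c w \<phi> u t) =
      (LINT t|cube_measure u. c * (\<Prod>j\<in>u. w j * (b j (t j) * \<phi> j (t j))))"
    unfolding tensor_deriv_def
    by (intro Bochner_Integration.integral_cong refl) (simp add: prod.distrib)
  also have "\<dots> = c * (\<Prod>j\<in>u. (LINT s|unit_interval. w j * (b j s * \<phi> j s)))"
    using assms finite_subset[OF assms(1)] integrable_factor
    by (subst integral_mult_right_zero, subst cube_integral_prod) auto
  finally show ?thesis by simp
qed

lemma sum_prod_Pow: "(\<Sum>u\<in>Pow {1..d}. c * (\<Prod>j\<in>u. v j)) = c * (\<Prod>j=1..d. 1 + v j)" for v :: "nat \<Rightarrow> real"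
  using prod_add[of "{1..d}" v "\<lambda>_. 1"] by (simp add: sum_distrib_left add.commute)

lemma has_mixed_derivs_tensor:
  assumes "1 < q"
  shows "has_mixed_derivs q d (tensor_fun d c w \<phi>) (tensor_deriv c w \<phi>)"
  unfolding has_mixed_derivs_def
proof (intro conjI allI impI ballI)
  fix x assume x: "x \<in> unit_cube {1..d}"
  have "set_lebesgue_integral (cube_measure u) (\<Pi>\<^sub>E j\<in>u. {0..x j}) (tensor_deriv c w \<phi> u) =
      c * (\<Prod>j\<in>u. w j * (LINT s|unit_interval. (if s \<le> x j then 1 else 0) * \<phi> j s))"
    if u: "u \<in> Pow {1..d}" for u
  proof -
    have fin: "finite u" using u finite_subset by auto
    have "set_lebesgue_integral (cube_measure u) (\<Pi>\<^sub>E j\<in>u. {0..x j}) (tensor_deriv c w \<phi> u) =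
      (LINT t|cube_measure u. (\<Prod>j\<in>u. if t j \<le> x j then 1 else 0) * tensor_deriv c w \<phi> u t)"
      unfolding set_lebesgue_integral_def
      by (intro Bochner_Integration.integral_cong refl)
         (simp add: indicator_box box_ind_prod[OF fin, symmetric])
    also have "\<dots> = c * (\<Prod>j\<in>u. w j * (LINT s|unit_interval. (if s \<le> x j then 1 else 0) * \<phi> j s))"
      using u by (intro integral_tensor_deriv) auto
    finally show ?thesis .
  qed
  then have "(\<Sum>u\<in>Pow {1..d}. set_lebesgue_integral (cube_measure u) (\<Pi>\<^sub>E j\<in>u. {0..x j}) (tensor_deriv c w \<phi> u)) =
      (\<Sum>u\<in>Pow {1..d}. c * (\<Prod>j\<in>u. w j * (LINT s|unit_interval. (if s \<le> x j then 1 else 0) * \<phi> j s)))"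
    by (intro sum.cong refl)
  then show "tensor_fun d c w \<phi> x = (\<Sum>u\<in>Pow {1..d}.
      set_lebesgue_integral (cube_measure u) (\<Pi>\<^sub>E j\<in>u. {0..x j}) (tensor_deriv c w \<phi> u))"
    unfolding sum_prod_Pow tensor_fun_def by simp
qed (rule in_Lq_tensor_deriv[OF assms])

lemma cube_integral_tensor:
  "cube_integral d (tensor_fun d c w \<phi>) =
     c * (\<Prod>j=1..d. 1 + w j * (LINT s|unit_interval. (1 - s) * \<phi> j s))"
proof -
  have "cube_integral d (tensor_fun d c w \<phi>) =
      (\<Sum>u\<in>Pow {1..d}. LINT t|cube_measure u. corner_volume u t * tensor_deriv c w \<phi> u t)"
    by (rule cube_integral_eq[OF _ has_mixed_derivs_tensor[of 2]]) auto
  also have "\<dots> = (\<Sum>u\<in>Pow {1..d}. c * (\<Prod>j\<in>u. w j * (LINT s|unit_interval. (1 - s) * \<phi> j s)))"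
    unfolding corner_volume_def by (intro sum.cong refl integral_tensor_deriv) auto
  finally show ?thesis unfolding sum_prod_Pow .
qed

text \<open>The choice \<open>w j = \<gamma> j powr (p / 2)\<close> reproduces itself in the norm:
  \<open>(p - 1) * q = p\<close> gives \<open>w j powr q / \<gamma> j powr (q / 2) = w j\<close>.
  The left-hand side of the last assumption is the \<open>q\<close>-th power of the norm.\<close>

lemma tensor_fun_unit_ball:
  assumes q: "1 < q" and conj: "1 / p + 1 / q = 1"
    and \<gamma>: "\<And>j. j \<in> {1..d} \<Longrightarrow> 0 < \<gamma> j" and w: "\<And>j. j \<in> {1..d} \<Longrightarrow> w j = \<gamma> j powr (p / 2)"
    and c: "\<bar>c\<bar> powr q * (\<Prod>j=1..d. 1 + w j * (LINT s|unit_interval. \<phi> j s powr q)) \<le> 1"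
  shows "tensor_fun d c w \<phi> \<in> unit_ball (ereal q) \<gamma> d"
proof (rule unit_ballI_finite[OF q has_mixed_derivs_tensor])
  have pq: "p * q / 2 - q / 2 = p / 2"
    using conj_exponent_mult[OF q conj] by (simp add: algebra_simps)
  have "1 / weight_prod \<gamma> u powr (q / 2) * (LINT t|cube_measure u. \<bar>tensor_deriv c w \<phi> u t\<bar> powr q) =
      \<bar>c\<bar> powr q * (\<Prod>j\<in>u. w j * (LINT s|unit_interval. \<phi> j s powr q))"
    if u: "u \<in> Pow {1..d}" for u
  proof -
    have fin: "finite u" using u finite_subset by auto
    have "(LINT t|cube_measure u. \<bar>tensor_deriv c w \<phi> u t\<bar> powr q) =
        (LINT t|cube_measure u. \<bar>c\<bar> powr q * (\<Prod>j\<in>u. w j powr q * \<phi> j (t j) powr q))"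
      using u \<phi>_bounds w_nonneg unit_cubeD[of _ u]
      by (intro Bochner_Integration.integral_cong refl)
         (auto simp: tensor_deriv_def abs_mult abs_prod powr_mult prod_powr_distrib prod_nonneg
           intro!: prod.cong)
    also have "\<dots> = \<bar>c\<bar> powr q * (\<Prod>j\<in>u. (LINT s|unit_interval. w j powr q * \<phi> j s powr q))"
    proof -
      have "integrable unit_interval (\<lambda>s. w j powr q * \<phi> j s powr q)" for j
        using \<phi>_bounds q
        by (intro integrable_mult_right integrable_unit_interval[of _ 1]) (auto intro!: powr_le1)
      then show ?thesis
        using fin by (subst integral_mult_right_zero, subst cube_integral_prod) auto
    qed
    finally have "1 / weight_prod \<gamma> u powr (q / 2) * (LINT t|cube_measure u. \<bar>tensor_deriv c w \<phi> u t\<bar> powr q) =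
        \<bar>c\<bar> powr q * (\<Prod>j\<in>u. (w j powr q / \<gamma> j powr (q / 2)) * (LINT s|unit_interval. \<phi> j s powr q))"
      by (simp add: weight_prod_def prod_powr_distrib prod.distrib prod_dividef)
    also have "\<dots> = \<bar>c\<bar> powr q * (\<Prod>j\<in>u. w j * (LINT s|unit_interval. \<phi> j s powr q))"
    proof -
      have "w j powr q / \<gamma> j powr (q / 2) = w j" if "j \<in> u" for j
      proof -
        have j: "j \<in> {1..d}" using that u by auto
        have "w j powr q / \<gamma> j powr (q / 2) = \<gamma> j powr (p * q / 2 - q / 2)"
          by (simp add: w[OF j] powr_powr powr_diff)
        then show ?thesis by (simp only: pq w[OF j])
      qed
      then show ?thesis by simp
    qed
    finally show ?thesis .
  qed
  then have "(\<Sum>u\<in>Pow {1..d}. 1 / weight_prod \<gamma> u powr (q / 2) *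
      (LINT t|cube_measure u. \<bar>tensor_deriv c w \<phi> u t\<bar> powr q)) =
      (\<Sum>u\<in>Pow {1..d}. \<bar>c\<bar> powr q * (\<Prod>j\<in>u. w j * (LINT s|unit_interval. \<phi> j s powr q)))"
    by (intro sum.cong refl)
  also have "\<dots> = \<bar>c\<bar> powr q * (\<Prod>j=1..d. 1 + w j * (LINT s|unit_interval. \<phi> j s powr q))"
    using prod_add[of "{1..d}" "\<lambda>j. w j * (LINT s|unit_interval. \<phi> j s powr q)" "\<lambda>_. 1"]
    by (simp add: sum_distrib_left add.commute)
  finally show "(\<Sum>u\<in>Pow {1..d}. 1 / weight_prod \<gamma> u powr (q / 2) *
      (LINT t|cube_measure u. \<bar>tensor_deriv c w \<phi> u t\<bar> powr q)) \<le> 1"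
    using c by simp
qed (use q in auto)

end

lemma initial_error_ge_1:
  assumes qp: "conj_exponents q p" and \<gamma>: "\<And>j. j \<in> {1..d} \<Longrightarrow> 0 < \<gamma> j"
  shows "1 \<le> initial_error q \<gamma> d"
proof -
  \<comment> \<open>The constant function 1 as a degenerate tensor product; its explicit derivative
    family is 1 for the empty set and 0 otherwise.\<close>
  let ?f = "tensor_fun d 1 (\<lambda>_. 0) (\<lambda>_ _. 0)"
  let ?g = "tensor_deriv 1 (\<lambda>_. 0) (\<lambda>_ _. 0)"
  have g: "has_mixed_derivs q d ?f ?g"
    using conj_exponents_bounds[OF qp] by (intro has_mixed_derivs_tensor) auto
  have "?f \<in> unit_ball q \<gamma> d"
    using qp unfolding conj_exponents_def
  proof
    assume "\<exists>r. q = ereal r \<and> 1 < r \<and> 1 / p + 1 / r = 1"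
    then obtain r where r: "q = ereal r" "1 < r" by auto
    have "(\<Sum>u\<in>Pow {1..d}. 1 / weight_prod \<gamma> u powr (r / 2) * (LINT t|cube_measure u. \<bar>?g u t\<bar> powr r)) =
        (\<Sum>u\<in>Pow {1..d}. if u = {} then 1 else 0)"
    proof (intro sum.cong refl)
      fix u assume "u \<in> Pow {1..d}"
      then have "finite u" using finite_subset by auto
      then show "1 / weight_prod \<gamma> u powr (r / 2) * (LINT t|cube_measure u. \<bar>?g u t\<bar> powr r) =
          (if u = {} then 1 else 0)"
        using r C.prob_space[of u] by (auto simp: tensor_deriv_def weight_prod_def)
    qed
    also have "\<dots> = 1" by simp
    finally show ?thesis
      using g r by (auto intro!: unit_ballI_finite)
  next
    assume q: "q = \<infinity> \<and> p = 1"
    have "weight_prod \<gamma> u powr (- (1/2)) * real_of_ereal (Linf_norm (cube_measure u) (?g u)) \<le> 1"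
      if u: "u \<subseteq> {1..d}" for u
    proof -
      have "finite u" using u finite_subset by auto
      then have "?g u = (\<lambda>_. if u = {} then 1 else 0)"
        by (auto simp: tensor_deriv_def fun_eq_iff)
      then have "Linf_norm (cube_measure u) (?g u) = ereal (if u = {} then 1 else 0)"
        unfolding Linf_norm_def using C.emeasure_space_1[of u] by (simp add: esssup_const)
      then show ?thesis by (simp add: weight_prod_def)
    qed
    then show ?thesis
      using g q by (auto intro!: unit_ballI_infinity)
  qed
  moreover have "cube_integral d ?f = 1"
    by (subst cube_integral_tensor) auto
  ultimately show ?thesis
    unfolding initial_error_def by (intro SUP_upper2[of ?f]) (auto simp: one_ereal_def)
qed

section \<open>Upper bound for the information complexity\<close>

text \<open>Since \<open>box_ind\<close> takes only the values \<open>0\<close> and \<open>1\<close>, the mean of the left-hand side over all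
  \<open>y\<close> equals \<open>\<Sum> V u \<integral> ((S u)\<^sup>2 + \<mu> - \<mu>\<^sup>2)\<close> with \<open>\<mu> = corner_volume u\<close>; some \<open>y\<close> does not exceed it.\<close>

lemma exists_next_node:
  fixes V :: "nat set \<Rightarrow> real" and S :: "nat set \<Rightarrow> (nat \<Rightarrow> real) \<Rightarrow> real"
  assumes V: "\<And>u. u \<subseteq> {1..d} \<Longrightarrow> 0 \<le> V u"
    and S_meas: "\<And>u. u \<subseteq> {1..d} \<Longrightarrow> S u \<in> borel_measurable (cube_measure u)"
    and S_bound: "\<And>u t. u \<subseteq> {1..d} \<Longrightarrow> t \<in> unit_cube u \<Longrightarrow> \<bar>S u t\<bar> \<le> B"
  shows "\<exists>y\<in>(\<Pi>\<^sub>E j\<in>{1..d}. {0..<1}).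
    (\<Sum>u\<in>Pow {1..d}. V u * (LINT t|cube_measure u. (S u t + (box_ind u y t - corner_volume u t))\<^sup>2)) \<le>
    (\<Sum>u\<in>Pow {1..d}. V u * (LINT t|cube_measure u. (S u t)\<^sup>2)) + (\<Sum>u\<in>Pow {1..d}. V u)"
proof (rule ccontr)
  define D where "D = {1..d}"
  define F where "F = (\<lambda>u y. LINT t|cube_measure u. (S u t + (box_ind u y t - corner_volume u t))\<^sup>2)"
  define R where "R = (\<Sum>u\<in>Pow D. V u * (LINT t|cube_measure u. (S u t)\<^sup>2)) + (\<Sum>u\<in>Pow D. V u)"
  assume "\<not> ?thesis"
  then have gt: "R < (\<Sum>u\<in>Pow D. V u * F u y)" if "y \<in> (\<Pi>\<^sub>E j\<in>D. {0..<1})" for y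
    using that by (auto simp: F_def R_def D_def not_le)
  have mean: "integrable (cube_measure D) (F u)"
       "(LINT y|cube_measure D. F u y) \<le> (LINT t|cube_measure u. (S u t)\<^sup>2) + 1" if u: "u \<in> Pow D" for u
  proof -
    have fin: "finite u" using u finite_subset by (auto simp: D_def)
    have [measurable]: "S u \<in> borel_measurable (cube_measure u)"
      using u S_meas by (auto simp: D_def)
    have SB: "\<bar>S u t\<bar> \<le> B" if "t \<in> unit_cube u" for t
      using that u S_bound by (auto simp: D_def)
    define a where "a = (\<lambda>t. (S u t - corner_volume u t)\<^sup>2)"
    define b where "b = (\<lambda>t. 1 + 2 * (S u t - corner_volume u t))"
    have diff: "\<bar>S u t - corner_volume u t\<bar> \<le> B + 1" if "t \<in> unit_cube u" for t
      using SB[OF that] corner_volume_bounds[OF that] by linarith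
    have a: "integrable (cube_measure u) a"
    proof (rule integrable_cube[of _ _ "(B + 1)\<^sup>2"])
      show "a \<in> borel_measurable (cube_measure u)" unfolding a_def by measurable
      show "\<bar>a t\<bar> \<le> (B + 1)\<^sup>2" if "t \<in> unit_cube u" for t
        using power_mono[OF diff[OF that], of 2] by (simp add: a_def)
    qed
    have b: "integrable (cube_measure u) b"
    proof (rule integrable_cube[of _ _ "1 + 2 * (B + 1)"])
      show "b \<in> borel_measurable (cube_measure u)" unfolding b_def by measurable
      show "\<bar>b t\<bar> \<le> 1 + 2 * (B + 1)" if "t \<in> unit_cube u" for t
        using diff[OF that] by (auto simp: b_def)
    qed
    \<comment> \<open>Because \<open>box_ind\<close> equals its own square, the expression is affine
      in it, and averaging over \<open>y\<close> becomes an instance of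
      \<open>integral_box_swap\<close>.\<close>
    have expand: "(S u t + (box_ind u y t - corner_volume u t))\<^sup>2 = a t + box_ind u y t * b t" for y t
      by (auto simp: a_def b_def box_ind_def power2_eq_square algebra_simps)
    have F: "F u = (\<lambda>y. (LINT t|cube_measure u. a t) + (LINT t|cube_measure u. box_ind u y t * b t))"
      unfolding F_def expand using a integrable_box_mult[OF fin b]
      by (intro ext Bochner_Integration.integral_add) auto
    have swap: "integrable (cube_measure D) (\<lambda>y. LINT t|cube_measure u. box_ind u y t * b t)"
      using u by (intro integral_box_swap(2) b) (auto simp: D_def)
    then show "integrable (cube_measure D) (F u)"
      unfolding F by (intro Bochner_Integration.integrable_add) auto
    have S2: "integrable (cube_measure u) (\<lambda>t. (S u t)\<^sup>2)"
      using SB power_mono[OF SB, of _ 2] by (intro integrable_cube[of _ _ "B\<^sup>2"]) auto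
    have "(LINT y|cube_measure D. F u y) =
        (LINT t|cube_measure u. a t) + (LINT y|cube_measure D. LINT t|cube_measure u. box_ind u y t * b t)"
      unfolding F using swap C.prob_space[of D] by simp
    also have "\<dots> = (LINT t|cube_measure u. a t + corner_volume u t * b t)"
      using u a integrable_corner_mult[OF b]
      by (subst integral_box_swap(1)[OF _ _ b]) (auto simp: D_def)
    also have "\<dots> \<le> (LINT t|cube_measure u. (S u t)\<^sup>2 + 1)"
    proof (rule integral_mono)
      show "a t + corner_volume u t * b t \<le> (S u t)\<^sup>2 + 1" if "t \<in> space (cube_measure u)" for t
      proof -
        have "a t + corner_volume u t * b t = (S u t)\<^sup>2 + corner_volume u t - (corner_volume u t)\<^sup>2"
          by (simp add: a_def b_def power2_eq_square algebra_simps)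
        then show ?thesis
          using corner_volume_bounds[of t u] that by (smt (verit) space_cube zero_le_power2)
      qed
    qed (use a integrable_corner_mult[OF b] S2 in auto)
    also have "\<dots> = (LINT t|cube_measure u. (S u t)\<^sup>2) + 1"
      using S2 C.prob_space[of u] by simp
    finally show "(LINT y|cube_measure D. F u y) \<le> (LINT t|cube_measure u. (S u t)\<^sup>2) + 1" .
  qed
  define X where "X = (\<lambda>y. \<Sum>u\<in>Pow D. V u * F u y)"
  have int: "integrable (cube_measure D) X"
    unfolding X_def using mean(1) by (intro Bochner_Integration.integrable_sum integrable_mult_right)
  have "(LINT y|cube_measure D. X y) = (\<Sum>u\<in>Pow D. V u * (LINT y|cube_measure D. F u y))"
    unfolding X_def using mean(1) by (subst Bochner_Integration.integral_sum) auto
  also have "\<dots> \<le> (\<Sum>u\<in>Pow D. V u * ((LINT t|cube_measure u. (S u t)\<^sup>2) + 1))"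
    using V mean(2) by (intro sum_mono mult_left_mono) (auto simp: D_def)
  also have "\<dots> = R"
    by (simp add: R_def sum.distrib distrib_left)
  finally have "(LINT y|cube_measure D. X y) \<le> R" .
  \<comment> \<open>The mean is taken over the closed cube, whereas nodes must lie in the half-open
    one. The difference is a null set, so the assumed strict inequality holds almost everywhere and
    passes to the mean.\<close>
  moreover have "(LINT y|cube_measure D. - X y) < - R"
  proof (rule C.expectation_less)
    have "AE y in cube_measure D. \<forall>j\<in>D. y j \<noteq> 1"
      by (rule AE_finite_allI) (auto simp: D_def intro: AE_cube_component_neq)
    then show "AE y in cube_measure D. - X y < - R"
      using AE_space
    proof eventually_elim
      case (elim y)
      have "y \<in> (\<Pi>\<^sub>E j\<in>D. {0..<1})"
        using elim by (auto simp: unit_cube_def PiE_iff order_less_le)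
      then show ?case using gt[of y] by (simp add: X_def)
    qed
  qed (use int in auto)
  ultimately show False by simp
qed

text \<open>For independent uniform nodes the centred indicators are uncorrelated, so the mean
  square of their sum grows linearly in \<open>N\<close>. Choosing each node no worse than average
  preserves this growth without randomness.\<close>

lemma exists_nodes:
  fixes V :: "nat set \<Rightarrow> real"
  assumes V: "\<And>u. u \<subseteq> {1..d} \<Longrightarrow> 0 \<le> V u"
  shows "\<exists>x. (\<forall>k\<in>{1..N}. x k \<in> (\<Pi>\<^sub>E j\<in>{1..d}. {0..<1})) \<and>
    (\<Sum>u\<in>Pow {1..d}. V u * (LINT t|cube_measure u. (\<Sum>k=1..N. box_ind u (x k) t - corner_volume u t)\<^sup>2)) \<le>
    real N * (\<Sum>u\<in>Pow {1..d}. V u)"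
proof (induction N)
  case (Suc N)
  then obtain x where x: "\<forall>k\<in>{1..N}. x k \<in> (\<Pi>\<^sub>E j\<in>{1..d}. {0..<1})"
    and le: "(\<Sum>u\<in>Pow {1..d}. V u * (LINT t|cube_measure u. (\<Sum>k=1..N. box_ind u (x k) t - corner_volume u t)\<^sup>2)) \<le>
      real N * (\<Sum>u\<in>Pow {1..d}. V u)"
    by blast
  define S where "S = (\<lambda>u t. \<Sum>k=1..N. box_ind u (x k) t - corner_volume u t)"
  have "\<exists>y\<in>(\<Pi>\<^sub>E j\<in>{1..d}. {0..<1}).
    (\<Sum>u\<in>Pow {1..d}. V u * (LINT t|cube_measure u. (S u t + (box_ind u y t - corner_volume u t))\<^sup>2)) \<le>
    (\<Sum>u\<in>Pow {1..d}. V u * (LINT t|cube_measure u. (S u t)\<^sup>2)) + (\<Sum>u\<in>Pow {1..d}. V u)"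
  proof (rule exists_next_node[OF V])
    fix u :: "nat set" assume u: "u \<subseteq> {1..d}"
    then have [measurable]: "\<And>y. box_ind u y \<in> borel_measurable (cube_measure u)"
      using finite_subset by (auto intro: box_ind_measurable)
    show "S u \<in> borel_measurable (cube_measure u)"
      unfolding S_def by measurable
    fix t assume t: "t \<in> unit_cube u"
    have "\<bar>S u t\<bar> \<le> (\<Sum>k=1..N. \<bar>box_ind u (x k) t - corner_volume u t\<bar>)"
      unfolding S_def by (rule sum_abs)
    also have "\<dots> \<le> (\<Sum>k=1..N. 1)"
      using corner_volume_bounds[OF t] by (intro sum_mono) (auto simp: box_ind_def)
    finally show "\<bar>S u t\<bar> \<le> real N" by simp
  qed
  then obtain y where y: "y \<in> (\<Pi>\<^sub>E j\<in>{1..d}. {0..<1})" and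
    le': "(\<Sum>u\<in>Pow {1..d}. V u * (LINT t|cube_measure u. (S u t + (box_ind u y t - corner_volume u t))\<^sup>2)) \<le>
    (\<Sum>u\<in>Pow {1..d}. V u * (LINT t|cube_measure u. (S u t)\<^sup>2)) + (\<Sum>u\<in>Pow {1..d}. V u)"
    by blast
  define x' where "x' = x(Suc N := y)"
  have "(\<Sum>k=1..Suc N. box_ind u (x' k) t - corner_volume u t) =
      S u t + (box_ind u y t - corner_volume u t)" for u t
    by (auto simp: x'_def S_def intro!: sum.cong)
  moreover have "\<forall>k\<in>{1..Suc N}. x' k \<in> (\<Pi>\<^sub>E j\<in>{1..d}. {0..<1})"
    using x y by (auto simp: x'_def le_Suc_eq)
  ultimately show ?case
    using le le' by (intro exI[of _ x']) (simp add: S_def algebra_simps)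
qed auto

text \<open>The square is traded for the \<open>p\<close>-th power through \<open>\<bar>D\<bar>\<^sup>p \<le> \<bar>D\<bar> \<le> (\<lambda> + D\<^sup>2 / \<lambda>) / 2\<close> with
  \<open>\<lambda> = N\<^sup>-\<^sup>1\<^sup>/\<^sup>2\<close>, which is valid because equal-weight discrepancies are bounded by \<open>1\<close>.\<close>

lemma exists_small_discrepancy:
  assumes p: "1 \<le> p" and \<gamma>: "\<And>j. j \<in> {1..d} \<Longrightarrow> 0 < \<gamma> j" and N: "1 \<le> N"
  shows "\<exists>x. (\<forall>k\<in>{1..N}. x k \<in> (\<Pi>\<^sub>E j\<in>{1..d}. {0..<1})) \<and>
    disc_norm_pow p \<gamma> d (discrepancy N (\<lambda>_. 1 / real N) x) \<le>
      real N powr (- (1/2)) * exp (\<Sum>j=1..d. \<gamma> j powr (p / 2))"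
proof -
  define V where "V = (\<lambda>u. weight_prod \<gamma> u powr (p / 2))"
  obtain x where x: "\<forall>k\<in>{1..N}. x k \<in> (\<Pi>\<^sub>E j\<in>{1..d}. {0..<1})"
    and le: "(\<Sum>u\<in>Pow {1..d}. V u * (LINT t|cube_measure u. (\<Sum>k=1..N. box_ind u (x k) t - corner_volume u t)\<^sup>2)) \<le>
      real N * (\<Sum>u\<in>Pow {1..d}. V u)"
    using exists_nodes[of d V N] by (auto simp: V_def)
  define D where "D = discrepancy N (\<lambda>_. 1 / real N) x"
  define l where "l = real N powr (- (1/2))"
  have l: "0 < l" using N by (simp add: l_def)
  have ll: "l * l = 1 / real N"
    using N by (simp add: l_def powr_add[symmetric] powr_minus field_simps)
  have D_eq: "D u t = - ((\<Sum>k=1..N. box_ind u (x k) t - corner_volume u t) / real N)" for u t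
    using N by (simp add: D_def discrepancy_def sum_subtractf sum_divide_distrib[symmetric] field_simps)
  have bound: "\<bar>D u t\<bar> powr p \<le> (l + (D u t)\<^sup>2 / l) / 2" if t: "t \<in> unit_cube u" for u t
  proof -
    have "(\<Sum>k=1..N. 1 / real N * box_ind u (x k) t) \<le> (\<Sum>k=1..N. 1 / real N)"
      by (intro sum_mono) (auto simp: box_ind_def)
    moreover have "0 \<le> (\<Sum>k=1..N. 1 / real N * box_ind u (x k) t)"
      by (intro sum_nonneg) (auto simp: box_ind_def)
    ultimately have "\<bar>D u t\<bar> \<le> 1"
      using corner_volume_bounds[OF t] N by (simp add: D_def discrepancy_def abs_le_iff)
    then have "\<bar>D u t\<bar> powr p \<le> \<bar>D u t\<bar> powr 1"
      using p by (intro powr_mono') auto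
    also have "\<dots> = \<bar>D u t\<bar>" by simp
    also have "\<dots> \<le> (l + (D u t)\<^sup>2 / l) / 2"
    proof -
      have "0 \<le> (l - \<bar>D u t\<bar>)\<^sup>2" by simp
      then have "2 * l * \<bar>D u t\<bar> \<le> l\<^sup>2 + (D u t)\<^sup>2"
        by (simp add: power2_diff)
      then show ?thesis using l by (simp add: field_simps power2_eq_square)
    qed
    finally show ?thesis .
  qed
  have "disc_norm_pow p \<gamma> d D \<le>
      (\<Sum>u\<in>Pow {1..d}. V u * ((l + (LINT t|cube_measure u. (D u t)\<^sup>2) / l) / 2))"
    unfolding disc_norm_pow_def V_def
  proof (intro sum_mono mult_left_mono)
    fix u assume u: "u \<in> Pow {1..d}"
    then have fin: "finite u" using finite_subset by auto
    have int: "integrable (cube_measure u) (\<lambda>t. (D u t)\<^sup>2)"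
      using integrable_discrepancy_powr[OF fin, of 2 N "\<lambda>_. 1 / real N" x] by (simp add: D_def)
    have "(LINT t|cube_measure u. \<bar>D u t\<bar> powr p) \<le> (LINT t|cube_measure u. (l + (D u t)\<^sup>2 / l) / 2)"
    proof (rule integral_mono)
      show "integrable (cube_measure u) (\<lambda>t. \<bar>D u t\<bar> powr p)"
        unfolding D_def using p fin by (intro integrable_discrepancy_powr) auto
    qed (use int bound in auto)
    also have "\<dots> = (l + (LINT t|cube_measure u. (D u t)\<^sup>2) / l) / 2"
      using int C.prob_space[of u] by simp
    finally show "(LINT t|cube_measure u. \<bar>D u t\<bar> powr p) \<le> \<dots>" .
  qed auto
  also have "\<dots> = (l * (\<Sum>u\<in>Pow {1..d}. V u) + (\<Sum>u\<in>Pow {1..d}. V u * (LINT t|cube_measure u. (D u t)\<^sup>2)) / l) / 2"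
    by (simp add: sum_distrib_left sum_divide_distrib sum.distrib add_divide_distrib algebra_simps)
  also have "\<dots> \<le> (l * (\<Sum>u\<in>Pow {1..d}. V u) + (l * l * (\<Sum>u\<in>Pow {1..d}. V u)) / l) / 2"
  proof -
    have "(LINT t|cube_measure u. (D u t)\<^sup>2) =
        (LINT t|cube_measure u. (\<Sum>k=1..N. box_ind u (x k) t - corner_volume u t)\<^sup>2) / (real N)\<^sup>2" for u
      by (simp add: D_eq power_divide)
    then have "(\<Sum>u\<in>Pow {1..d}. V u * (LINT t|cube_measure u. (D u t)\<^sup>2)) =
        (\<Sum>u\<in>Pow {1..d}. V u * (LINT t|cube_measure u. (\<Sum>k=1..N. box_ind u (x k) t - corner_volume u t)\<^sup>2)) / (real N)\<^sup>2"
      by (simp only: times_divide_eq_right sum_divide_distrib)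
    also have "\<dots> \<le> real N * (\<Sum>u\<in>Pow {1..d}. V u) / (real N)\<^sup>2"
      using le by (intro divide_right_mono) auto
    also have "\<dots> = l * l * (\<Sum>u\<in>Pow {1..d}. V u)"
      unfolding ll by (simp add: power2_eq_square)
    finally show ?thesis
      using l by (intro divide_right_mono add_left_mono) auto
  qed
  also have "\<dots> = l * (\<Sum>u\<in>Pow {1..d}. V u)"
    using l by simp
  \<comment> \<open>The sum over subsets is a product with factors
    \<open>1 + \<gamma> j powr (p / 2)\<close>, each at most the exponential of its second
    term.\<close>
  also have "(\<Sum>u\<in>Pow {1..d}. V u) = (\<Prod>j=1..d. 1 + \<gamma> j powr (p / 2))"
    using prod_add[of "{1..d}" "\<lambda>j. \<gamma> j powr (p / 2)" "\<lambda>_. 1"]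
    by (simp add: V_def weight_prod_def prod_powr_distrib add.commute)
  also have "l * \<dots> \<le> l * exp (\<Sum>j=1..d. \<gamma> j powr (p / 2))"
    using l by (intro mult_left_mono) (auto simp: exp_sum intro!: prod_mono add_nonneg_nonneg)
  finally show ?thesis
    using x by (auto simp: D_def l_def)
qed

section \<open>From small discrepancy to the number of nodes\<close>

lemma half_open_cube_subset: "(\<Pi>\<^sub>E j\<in>{1..d}. {0..<1}) \<subseteq> unit_cube {1..d}"
  by (auto simp: unit_cube_def PiE_iff less_imp_le)

text \<open>An absolute error \<epsilon> is enough, because the initial error is at least 1. The
  rule has equal weights \<open>1 / real N\<close>.\<close>

lemma minimal_error_le:
  assumes qp: "conj_exponents q p" and \<gamma>: "\<And>j. j \<in> {1..d} \<Longrightarrow> 0 < \<gamma> j" and N: "1 \<le> N" and \<epsilon>: "0 < \<epsilon>"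
    and le: "real N powr (- (1/2)) * exp (\<Sum>j=1..d. \<gamma> j powr (p / 2)) \<le> \<epsilon> powr p"
  shows "minimal_error q \<gamma> N d \<le> ereal \<epsilon> * initial_error q \<gamma> d"
proof -
  obtain x where x: "\<forall>k\<in>{1..N}. x k \<in> (\<Pi>\<^sub>E j\<in>{1..d}. {0..<1})"
    and disc: "disc_norm_pow p \<gamma> d (discrepancy N (\<lambda>_. 1 / real N) x) \<le>
      real N powr (- (1/2)) * exp (\<Sum>j=1..d. \<gamma> j powr (p / 2))"
    using exists_small_discrepancy[where \<gamma> = \<gamma> and d = d, OF conj_exponents_bounds(2)[OF qp] \<gamma> N] by blast
  have xu: "x k \<in> unit_cube {1..d}" if "k \<in> {1..N}" for k
    using x that half_open_cube_subset by blast
  have "((\<lambda>_. 1 / real N), x) \<in> positive_rules N d"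
    using x by (auto simp: positive_rules_def)
  then have "minimal_error q \<gamma> N d \<le> worst_case_error q \<gamma> d (quadrature N (\<lambda>_. 1 / real N) x)"
    unfolding minimal_error_def by (intro INF_lower2) auto
  also have "\<dots> \<le> ereal \<epsilon>"
    unfolding worst_case_error_def
    using error_le[OF qp \<gamma> _ xu \<epsilon>] disc le by (intro SUP_least) (auto intro: order_trans)
  also have "\<dots> = ereal \<epsilon> * 1" by simp
  also have "\<dots> \<le> ereal \<epsilon> * initial_error q \<gamma> d"
    using initial_error_ge_1[OF qp \<gamma>] \<epsilon> by (intro ereal_mult_left_mono) auto
  finally show ?thesis .
qed

lemma information_complexity_le:
  assumes qp: "conj_exponents q p" and \<gamma>: "\<And>j. j \<in> {1..d} \<Longrightarrow> 0 < \<gamma> j" and \<epsilon>: "0 < \<epsilon>" "\<epsilon> < 1"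
  defines "N \<equiv> information_complexity q \<gamma> \<epsilon> d"
  shows "1 \<le> N" "minimal_error q \<gamma> N d \<le> ereal \<epsilon> * initial_error q \<gamma> d"
    "real N \<le> 2 * \<epsilon> powr (- (2 * p)) * exp (2 * (\<Sum>j=1..d. \<gamma> j powr (p / 2)))"
proof -
  let ?P = "\<lambda>N. 1 \<le> N \<and> minimal_error q \<gamma> N d \<le> ereal \<epsilon> * initial_error q \<gamma> d"
  define s where "s = (\<Sum>j=1..d. \<gamma> j powr (p / 2))"
  \<comment> \<open>The solution of
    \<open>b powr (- (1/2)) * exp s = \<epsilon> powr p\<close>.\<close>
  define b where "b = \<epsilon> powr (- (2 * p)) * exp (2 * s)"
  have p: "1 \<le> p" using conj_exponents_bounds[OF qp] by simp
  have s: "0 \<le> s" by (auto simp: s_def intro: sum_nonneg)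
  have b: "1 \<le> b"
  proof -
    have "1 \<le> \<epsilon> powr (- (2 * p))"
      using \<epsilon> p powr_mono'[of "- (2 * p)" 0 \<epsilon>] by simp
    moreover have "1 \<le> exp (2 * s)" using s by simp
    ultimately show ?thesis unfolding b_def by (metis mult_mono' mult_1 zero_le_one)
  qed
  define M where "M = nat \<lceil>b\<rceil>"
  have M: "b \<le> real M" "real M \<le> b + 1" "1 \<le> M"
    using b by (auto simp: M_def) linarith+
  have "real M powr (- (1/2)) * exp s \<le> b powr (- (1/2)) * exp s"
    using M b by (intro mult_right_mono powr_mono2') auto
  also have "\<dots> = \<epsilon> powr p"
    using \<epsilon> by (simp add: b_def powr_mult powr_powr exp_powr_real exp_minus)
  finally have "?P M"
    using minimal_error_le[OF qp \<gamma> M(3) \<epsilon>(1)] M(3) by (simp add: s_def)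
  then have "?P N" "N \<le> M"
    unfolding N_def information_complexity_def by (rule LeastI, rule Least_le)
  then show "1 \<le> N" "minimal_error q \<gamma> N d \<le> ereal \<epsilon> * initial_error q \<gamma> d" by auto
  \<comment> \<open>Rounding \<open>b\<close> up costs at most 1, which is at most \<open>b\<close>;
    hence the factor 2.\<close>
  have "real N \<le> 2 * b" using \<open>N \<le> M\<close> M b by linarith
  then show "real N \<le> 2 * \<epsilon> powr (- (2 * p)) * exp (2 * (\<Sum>j=1..d. \<gamma> j powr (p / 2)))"
    by (simp add: b_def s_def)
qed

section \<open>Lower bound for the information complexity\<close>

lemma integral_one_minus_powr:
  assumes "0 \<le> a"
  shows "(LINT s|unit_interval. (1 - s) powr a) = 1 / (a + 1)"
proof (rule integral_unit_interval[of _ _ 1])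
  let ?F = "\<lambda>s::real. - ((1 - s) powr (a + 1)) / (a + 1)"
  have "((\<lambda>s. (1 - s) powr a) has_integral (?F 1 - ?F 0)) {0..1}"
  \<comment> \<open>The interior version asks for derivatives only where the base
    \<open>1 - s\<close> is positive; at \<open>s = 1\<close> continuity suffices.\<close>
  proof (rule fundamental_theorem_of_calculus_interior)
    show "continuous_on {0..1} ?F"
      using assms by (intro continuous_intros continuous_on_powr') auto
    fix s :: real assume s: "s \<in> {0<..<1}"
    have "((\<lambda>s. 1 - s) has_real_derivative - 1) (at s)"
      by (auto intro!: derivative_eq_intros)
    then have "((\<lambda>s. (1 - s) powr (a + 1)) has_real_derivative
        (a + 1) * (1 - s) powr (a + 1 - 1) * - 1) (at s)"
      using s by (intro DERIV_chain2[OF has_real_derivative_powr]) auto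
    then have "(?F has_real_derivative - ((a + 1) * (1 - s) powr (a + 1 - 1) * - 1) / (a + 1)) (at s)"
      by (intro DERIV_cdivide DERIV_minus)
    then have "(?F has_real_derivative (1 - s) powr a) (at s)"
      using assms by simp
    then show "(?F has_vector_derivative (1 - s) powr a) (at s)"
      by (simp add: has_real_derivative_iff_has_vector_derivative)
  qed simp
  then show "((\<lambda>s. (1 - s) powr a) has_integral 1 / (a + 1)) {0..1}"
    using assms by simp
  show "\<bar>(1 - t) powr a\<bar> \<le> 1" if "t \<in> {0..1}" for t :: real
    using that assms by (auto intro: powr_le1)
qed auto

lemma integral_indicator_interval:
  assumes "0 \<le> a" "a \<le> b" "b \<le> 1"
  shows "(LINT s|unit_interval. (if a \<le> s \<and> s \<le> b then 1 else 0)) = b - a"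
proof (rule integral_unit_interval[of _ _ 1])
  have "((\<lambda>x. 1::real) has_integral (b - a)) {a..b}"
    using has_integral_const_real[of "1::real" a b] assms by simp
  then have "((\<lambda>x. if x \<in> {a..b} then 1 else 0::real) has_integral (b - a)) {0..1}"
    using assms by (subst has_integral_restrict) auto
  then show "((\<lambda>s. if a \<le> s \<and> s \<le> b then 1 else 0) has_integral b - a) {0..1}"
    by (rule has_integral_eq[rotated]) auto
qed auto

lemma integral_indicator_le:
  assumes "0 \<le> y" "y \<le> 1"
  shows "(LINT s|unit_interval. (if s \<le> y then 1 else 0)) = y"
proof -
  have "(LINT s|unit_interval. (if s \<le> y then 1 else 0)) =
      (LINT s|unit_interval. (if 0 \<le> s \<and> s \<le> y then 1 else (0::real)))"
    by (intro Bochner_Integration.integral_cong refl) auto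
  then show ?thesis using integral_indicator_interval[of 0 y] assms by simp
qed

text \<open>A quantitative Hoelder inequality on \<open>[0,1]\<close> with an extra atom, whose defect is linear in the
  weight \<open>w\<close> and uniform in \<open>y\<close>: on a fixed interval close to \<open>1\<close> the function \<open>(1 - s)\<^sup>p\<^sup>-\<^sup>1\<close> is so
  small that the two arguments of Young's inequality are far apart, whether or not \<open>s \<le> y\<close>.\<close>

lemma hoelder_gap:
  fixes p q :: real
  assumes p: "1 < p" and q: "1 < q" and conj: "1 / p + 1 / q = 1"
  shows "\<exists>c>0. \<forall>w y. 0 \<le> w \<and> w \<le> 1 \<and> 0 \<le> y \<and> y \<le> 1 \<longrightarrow>
    1 + w * (LINT s|unit_interval. (if s \<le> y then 1 else 0) * (1 - s) powr (p - 1)) \<le>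
      exp (- c * w) * ((1 + w * y) powr (1 / p) * (1 + w / (p + 1)) powr (1 / q))"
proof -
  \<comment> \<open>Chosen so that \<open>\<delta> powr (p - 1) = 1 / (4 * p)\<close>: where
    \<open>1 - s \<le> \<delta>\<close>, the product in Young's inequality is at most half of
    \<open>1 / (2 * p)\<close>, a lower bound for its first term.\<close>
  define \<delta> where "\<delta> = (1 / (4 * p)) powr (1 / (p - 1))"
  \<comment> \<open>The smaller of the two gains on the interval where
    \<open>\<delta> / 2 \<le> 1 - s \<le> \<delta>\<close>: the first entry belongs to
    \<open>s \<le> y\<close>, the second to \<open>s > y\<close>, where the product vanishes and the
    second Young term remains. The interval has length \<open>\<delta> / 2\<close>, which explains
    \<open>c\<close>.\<close>
  define m where "m = min (1 / (4 * p)) ((\<delta> / 2) powr p / (2 * q))"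
  define c where "c = m * (\<delta> / 2)"
  have \<delta>: "0 < \<delta>" "\<delta> \<le> 1"
    using p by (auto simp: \<delta>_def intro!: powr_le1)
  have \<delta>p: "\<delta> powr (p - 1) = 1 / (4 * p)"
    using p by (simp add: \<delta>_def powr_powr)
  have m: "0 < m" "m \<le> 1 / (4 * p)" "m \<le> (\<delta> / 2) powr p / (2 * q)"
    using p q \<delta> by (auto simp: m_def)
  have c: "0 < c" using m \<delta> by (simp add: c_def)
  have pq: "(p - 1) * q = p" using q conj by (rule conj_exponent_mult)
  have main: "1 + w * (LINT s|unit_interval. (if s \<le> y then 1 else 0) * (1 - s) powr (p - 1)) \<le>
      exp (- c * w) * ((1 + w * y) powr (1 / p) * (1 + w / (p + 1)) powr (1 / q))"
    if w: "0 \<le> w" "w \<le> 1" and y: "0 \<le> y" "y \<le> 1" for w y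
  proof -
    define X where "X = 1 + w * y"
    define Y where "Y = 1 + w / (p + 1)"
    have "w * y \<le> 1" "w / (p + 1) \<le> 1"
      using w y p by (auto simp: mult_le_one)
    moreover have "0 \<le> w * y" "0 \<le> w / (p + 1)"
      using w y p by auto
    ultimately have XY: "1 \<le> X" "X \<le> 2" "1 \<le> Y" "Y \<le> 2"
      unfolding X_def Y_def by linarith+
    \<comment> \<open>\<alpha> and \<beta> normalize the two functions: \<open>X\<close> is the
      \<open>p\<close>-th power of the norm of the step function and \<open>Y\<close> the
      \<open>q\<close>-th power of that of \<open>(1 - s) powr (p - 1)\<close>, for the measure with
      an atom of mass 1 and density \<open>w\<close>. Both lie between 1 and 2, which keeps all
      constants uniform.\<close>
    define \<alpha> where "\<alpha> = X powr (- (1 / p))"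
    define \<beta> where "\<beta> = Y powr (- (1 / q))"
    have ab: "0 < \<alpha>" "\<alpha> \<le> 1" "0 < \<beta>" "\<beta> \<le> 1"
      using XY p q powr_mono[of "- (1 / p)" 0 X] powr_mono[of "- (1 / q)" 0 Y]
      by (auto simp: \<alpha>_def \<beta>_def)
    have "\<alpha> powr p = X powr (- 1)" "\<beta> powr q = Y powr (- 1)"
    proof -
      have "- (1 / p) * p = - 1" "- (1 / q) * q = - 1" using p q by simp_all
      then show "\<alpha> powr p = X powr (- 1)" "\<beta> powr q = Y powr (- 1)"
        by (simp_all only: \<alpha>_def \<beta>_def powr_powr)
    qed
    then have ap: "\<alpha> powr p = 1 / X" and bq: "\<beta> powr q = 1 / Y"
      using XY powr_minus_divide[of X 1] powr_minus_divide[of Y 1] by simp_all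
    define step where "step = (\<lambda>s::real. if s \<le> y then 1 else (0::real))"
    define gap where "gap = (\<lambda>s::real. if 1 - \<delta> \<le> s \<and> s \<le> 1 - \<delta> / 2 then 1 else (0::real))"
    define A where "A = (LINT s|unit_interval. step s * (1 - s) powr (p - 1))"
    have pointwise: "\<alpha> * \<beta> * (step s * (1 - s) powr (p - 1)) \<le>
        \<alpha> powr p / p * step s + \<beta> powr q / q * (1 - s) powr p - m * gap s"
      if s: "0 \<le> s" "s \<le> 1" for s
    proof -
      define B where "B = \<beta> * (1 - s) powr (p - 1)"
      have B: "0 \<le> B" using ab by (simp add: B_def)
      have Bq: "B powr q = \<beta> powr q * (1 - s) powr p"
        using ab s by (simp add: B_def powr_mult powr_powr pq)
      have young: "\<alpha> * B \<le> \<alpha> powr p / p + B powr q / q"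
        using Youngs_inequality[OF p q conj] ab B by auto
      show ?thesis
      proof (cases "gap s = 0")
        case True
        have "0 \<le> \<beta> powr q / q * (1 - s) powr p" using q by simp
        then have "\<alpha> * B * step s \<le> \<alpha> powr p / p * step s + \<beta> powr q / q * (1 - s) powr p"
          using young unfolding Bq by (cases "s \<le> y") (simp_all add: step_def)
        then show ?thesis
          unfolding True B_def by (simp add: mult_ac)
      next
        case False
        then have sg: "1 - \<delta> \<le> s" "s \<le> 1 - \<delta> / 2" "gap s = 1"
          by (auto simp: gap_def split: if_splits)
        show ?thesis
        proof (cases "s \<le> y")
          case True
          have "(1 - s) powr (p - 1) \<le> \<delta> powr (p - 1)"
            using sg s p by (intro powr_mono2) auto
          moreover have "\<alpha> * \<beta> * (1 - s) powr (p - 1) \<le> 1 * (1 - s) powr (p - 1)"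
            using ab by (intro mult_right_mono mult_le_one) auto
          ultimately have "\<alpha> * \<beta> * (1 - s) powr (p - 1) \<le> 1 / (4 * p)"
            using \<delta>p by simp
          moreover have "1 / (2 * p) \<le> \<alpha> powr p / p"
            using XY p by (simp add: ap field_simps)
          moreover have "1 / (2 * p) = 1 / (4 * p) + 1 / (4 * p)" by simp
          moreover have "0 \<le> \<beta> powr q / q * (1 - s) powr p" using q by simp
          moreover have st: "step s = 1" using True by (simp add: step_def)
          ultimately show ?thesis
            unfolding st sg(3) mult_1_right mult_1_left using m(2) by linarith
        next
          case False
          have "(\<delta> / 2) powr p \<le> (1 - s) powr p"
            using sg s p \<delta> by (intro powr_mono2) auto
          moreover have "1 / 2 \<le> \<beta> powr q" using XY by (simp add: bq field_simps)
          ultimately have "1 / 2 * (\<delta> / 2) powr p \<le> \<beta> powr q * (1 - s) powr p"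
            by (intro mult_mono) auto
          then have "1 / 2 * (\<delta> / 2) powr p / q \<le> \<beta> powr q * (1 - s) powr p / q"
            using q by (intro divide_right_mono) auto
          then have "m \<le> \<beta> powr q / q * (1 - s) powr p"
            using m(3) by (simp only: times_divide_eq_left divide_divide_eq_left mult_1_left)
          then show ?thesis
            using False by (simp add: step_def sg(3))
        qed
      qed
    qed
    have le1: "(1 - s) powr e \<le> 1" if "0 \<le> e" "s \<in> {0..1}" for s e :: real
      using that by (auto intro: powr_le1)
    have int_step: "integrable unit_interval step"
      unfolding step_def by (rule integrable_unit_interval[of _ 1]) auto
    have intg: "integrable unit_interval gap"
      unfolding gap_def by (rule integrable_unit_interval[of _ 1]) auto
    have intp: "integrable unit_interval (\<lambda>s. (1 - s) powr p)"
      using le1[of p] p by (intro integrable_unit_interval[of _ 1]) auto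
    have intA: "integrable unit_interval (\<lambda>s. step s * (1 - s) powr (p - 1))"
      using le1[of "p - 1"] p by (intro integrable_unit_interval[of _ 1]) (auto simp: step_def)
    have "\<alpha> * \<beta> * A = (LINT s|unit_interval. \<alpha> * \<beta> * (step s * (1 - s) powr (p - 1)))"
      unfolding A_def by simp
    also have "\<dots> \<le> (LINT s|unit_interval. \<alpha> powr p / p * step s + \<beta> powr q / q * (1 - s) powr p - m * gap s)"
    proof (rule integral_mono)
      show "integrable unit_interval (\<lambda>s. \<alpha> * \<beta> * (step s * (1 - s) powr (p - 1)))"
        using intA by (rule integrable_mult_right)
      show "integrable unit_interval (\<lambda>s. \<alpha> powr p / p * step s + \<beta> powr q / q * (1 - s) powr p - m * gap s)"
        using int_step intg intp by simp
    qed (simp only: space_unit_interval atLeastAtMost_iff pointwise)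
    also have "\<dots> = \<alpha> powr p / p * integral\<^sup>L unit_interval step +
        \<beta> powr q / q * (LINT s|unit_interval. (1 - s) powr p) - m * integral\<^sup>L unit_interval gap"
      using int_step intg intp by simp
    also have "\<dots> = \<alpha> powr p / p * y + \<beta> powr q / q * (1 / (p + 1)) - c"
    proof -
      have "integral\<^sup>L unit_interval step = y"
        unfolding step_def using y by (rule integral_indicator_le)
      moreover have "integral\<^sup>L unit_interval gap = \<delta> / 2"
        unfolding gap_def using \<delta> by (subst integral_indicator_interval) auto
      ultimately show ?thesis
        using p by (simp add: integral_one_minus_powr c_def)
    qed
    finally have "w * (\<alpha> * \<beta> * A) \<le> w * (\<alpha> powr p / p * y + \<beta> powr q / q * (1 / (p + 1)) - c)"
      using w by (intro mult_left_mono) auto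
    \<comment> \<open>The contribution of the atom, where both functions have the value 1 and no
      gain is claimed.\<close>
    moreover have "\<alpha> * \<beta> \<le> \<alpha> powr p / p + \<beta> powr q / q"
      using Youngs_inequality[OF p q conj] ab by auto
    ultimately have "\<alpha> * \<beta> + w * (\<alpha> * \<beta> * A) \<le>
        (\<alpha> powr p / p + \<beta> powr q / q) + w * (\<alpha> powr p / p * y + \<beta> powr q / q * (1 / (p + 1)) - c)"
      by (intro add_mono)
    also have "\<dots> = \<alpha> powr p / p * X + \<beta> powr q / q * Y - c * w"
    proof -
      have "(a + b) + w * (a * y + b * (1 / (p + 1)) - c) = a * (1 + w * y) + b * (1 + w / (p + 1)) - c * w"
        for a b by (simp add: algebra_simps)
      then show ?thesis by (simp only: X_def Y_def)
    qed
    also have "\<dots> = 1 - c * w"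
    proof -
      have "\<alpha> powr p / p * X = 1 / p" "\<beta> powr q / q * Y = 1 / q"
        using XY by (simp_all add: ap bq)
      then show ?thesis using conj by (simp only:)
    qed
    also have "\<dots> \<le> exp (- c * w)"
      using exp_ge_add_one_self[of "- c * w"] by simp
    finally have "\<alpha> * \<beta> * (1 + w * A) \<le> exp (- c * w)"
      by (simp only: distrib_left mult_1_right mult_ac)
    then have le: "\<alpha> * \<beta> * (1 + w * A) * (X powr (1 / p) * Y powr (1 / q)) \<le>
        exp (- c * w) * (X powr (1 / p) * Y powr (1 / q))"
      by (rule mult_right_mono) simp
    have one: "\<alpha> * X powr (1 / p) = 1" "\<beta> * Y powr (1 / q) = 1"
      using XY unfolding \<alpha>_def \<beta>_def powr_add[symmetric] by simp_all
    have "\<alpha> * \<beta> * (1 + w * A) * (X powr (1 / p) * Y powr (1 / q)) =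
        (\<alpha> * X powr (1 / p)) * (\<beta> * Y powr (1 / q)) * (1 + w * A)"
      by (simp only: mult_ac)
    also have "\<dots> = 1 + w * A"
      by (simp only: one mult_1)
    finally show ?thesis
      using le by (simp only: X_def Y_def A_def step_def)
  qed
  show ?thesis
    by (intro exI[of _ c] conjI allI impI c main) (simp_all only:)
qed

section \<open>Test functions against a positive rule\<close>

lemma quadrature_cmult: "quadrature N a x (\<lambda>y. c * f y) = c * quadrature N a x f"
  by (simp add: quadrature_def sum_distrib_left mult_ac)

lemma tensor_fun_cmult: "tensor_fun d c w \<phi> = (\<lambda>y. c * tensor_fun d 1 w \<phi> y)"
  by (simp add: tensor_fun_def fun_eq_iff)

text \<open>Homogeneity: the product on the right is the \<open>q\<close>-th power \<open>n\<close>
  of the norm, and multiplication by \<open>n powr (- (1 / q))\<close> brings the function into the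
  unit ball while scaling its error linearly.\<close>

lemma tensor_fun_error:
  fixes w :: "nat \<Rightarrow> real" and \<phi> :: "nat \<Rightarrow> real \<Rightarrow> real"
  assumes \<phi>_meas: "\<And>j. \<phi> j \<in> borel_measurable borel"
    and \<phi>_bounds: "\<And>j t. 0 \<le> t \<Longrightarrow> t \<le> 1 \<Longrightarrow> 0 \<le> \<phi> j t \<and> \<phi> j t \<le> 1"
    and q: "1 < q" and conj: "1 / p + 1 / q = 1"
    and \<gamma>: "\<And>j. j \<in> {1..d} \<Longrightarrow> 0 < \<gamma> j" and w: "\<And>j. j \<in> {1..d} \<Longrightarrow> w j = \<gamma> j powr (p / 2)"
    and err: "\<And>f. f \<in> unit_ball (ereal q) \<gamma> d \<Longrightarrow> \<bar>cube_integral d f - quadrature N a x f\<bar> \<le> \<delta>"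
  shows "\<bar>cube_integral d (tensor_fun d 1 w \<phi>) - quadrature N a x (tensor_fun d 1 w \<phi>)\<bar> \<le>
    \<delta> * (\<Prod>j=1..d. 1 + w j * (LINT s|unit_interval. \<phi> j s powr q)) powr (1 / q)"
proof -
  let ?f = "\<lambda>c. tensor_fun d c w \<phi>"
  define n where "n = (\<Prod>j=1..d. 1 + w j * (LINT s|unit_interval. \<phi> j s powr q))"
  have w0: "0 \<le> w j" if "j \<in> {1..d}" for j using w[OF that] by simp
  have n: "0 < n"
    unfolding n_def using w0
    by (intro prod_pos ballI add_pos_nonneg mult_nonneg_nonneg) (auto intro!: integral_nonneg_AE)
  define c where "c = n powr (- (1 / q))"
  have c: "0 < c" using n by (simp add: c_def)
  have cn: "c * n powr (1 / q) = 1"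
    using n unfolding c_def powr_add[symmetric] by simp
  have "c powr q * n = 1"
  proof -
    have "c powr q = n powr (- 1)"
      using q unfolding c_def powr_powr by simp
    then show ?thesis using n powr_minus_divide[of n 1] by simp
  qed
  then have "?f c \<in> unit_ball (ereal q) \<gamma> d"
    using c by (intro tensor_fun_unit_ball[OF \<phi>_meas \<phi>_bounds w0 q conj \<gamma> w]) (auto simp: n_def)
  then have "\<bar>cube_integral d (?f c) - quadrature N a x (?f c)\<bar> \<le> \<delta>"
    by (rule err)
  moreover have "cube_integral d (?f c) = c * cube_integral d (?f 1)"
    by (subst (1 2) cube_integral_tensor[OF \<phi>_meas \<phi>_bounds w0]) auto
  moreover have "quadrature N a x (?f c) = c * quadrature N a x (?f 1)"
    by (subst tensor_fun_cmult) (rule quadrature_cmult)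
  ultimately have "c * \<bar>cube_integral d (?f 1) - quadrature N a x (?f 1)\<bar> \<le> \<delta>"
    using c by (simp add: right_diff_distrib[symmetric] abs_mult)
  then have "n powr (1 / q) * (c * \<bar>cube_integral d (?f 1) - quadrature N a x (?f 1)\<bar>) \<le> n powr (1 / q) * \<delta>"
    by (rule mult_left_mono) simp
  then have "(c * n powr (1 / q)) * \<bar>cube_integral d (?f 1) - quadrature N a x (?f 1)\<bar> \<le> n powr (1 / q) * \<delta>"
    by (simp only: mult_ac)
  then show ?thesis
    unfolding cn n_def[symmetric] by (simp add: mult.commute)
qed

text \<open>The rule without nodes is the zero functional, so this is the \<open>p\<close>-th power
  of the Hoelder bound for the initial error. The discrepancy is then the pure product of
  \<open>1 - t j\<close>, and each coordinate contributes \<open>1 / (p + 1)\<close>.\<close>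

lemma disc_norm_pow_initial:
  assumes "0 \<le> p"
  shows "disc_norm_pow p \<gamma> d (discrepancy 0 a x) = (\<Prod>j=1..d. 1 + \<gamma> j powr (p / 2) / (p + 1))"
proof -
  have "weight_prod \<gamma> u powr (p / 2) * (LINT t|cube_measure u. \<bar>discrepancy 0 a x u t\<bar> powr p) =
      (\<Prod>j\<in>u. \<gamma> j powr (p / 2) / (p + 1)) * (\<Prod>j\<in>{1..d} - u. 1)" if u: "u \<in> Pow {1..d}" for u
  proof -
    have fin: "finite u" using u finite_subset by auto
    have "(LINT t|cube_measure u. \<bar>discrepancy 0 a x u t\<bar> powr p) =
        (LINT t|cube_measure u. (\<Prod>j\<in>u. (1 - t j) powr p))"
      using unit_cubeD[of _ u]
      by (intro Bochner_Integration.integral_cong refl)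
         (auto simp: discrepancy_def corner_volume_def abs_prod prod_powr_distrib intro!: prod.cong)
    also have "\<dots> = (\<Prod>j\<in>u. (LINT s|unit_interval. (1 - s) powr p))"
      using assms fin by (intro cube_integral_prod integrable_unit_interval[of _ 1]) (auto intro: powr_le1)
    finally show ?thesis
      using assms by (simp add: integral_one_minus_powr weight_prod_def prod_powr_distrib prod_dividef power_divide)
  qed
  then have "disc_norm_pow p \<gamma> d (discrepancy 0 a x) =
      (\<Sum>u\<in>Pow {1..d}. (\<Prod>j\<in>u. \<gamma> j powr (p / 2) / (p + 1)) * (\<Prod>j\<in>{1..d} - u. 1))"
    unfolding disc_norm_pow_def by (intro sum.cong refl)
  also have "\<dots> = (\<Prod>j=1..d. \<gamma> j powr (p / 2) / (p + 1) + 1)"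
    by (rule prod_add[symmetric]) simp
  finally show ?thesis by (simp add: add.commute)
qed

text \<open>If the rule integrates the worst-case function \<open>h\<close> reasonably well, then \<open>\<Sum> a\<^sub>k h(x\<^sub>k)\<close> is large.
  For every node the minimal-norm function \<open>s\<^sub>k\<close> proportional to \<open>\<Prod> (1 + w\<^sub>j min(\<cdot>, x\<^sub>k\<^sub>j))\<close> bounds
  \<open>a\<^sub>k h(x\<^sub>k) \<le> A(s\<^sub>k)\<close> from above by a multiple of its norm, which is exponentially smaller than
  that of \<open>h\<close>.\<close>

lemma positive_rule_lower_bound:
  fixes q p :: real
  assumes q: "1 < q" and conj: "1 / p + 1 / q = 1" and p: "1 < p"
    and gap: "\<And>w y. 0 \<le> w \<Longrightarrow> w \<le> 1 \<Longrightarrow> 0 \<le> y \<Longrightarrow> y \<le> 1 \<Longrightarrow>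
      1 + w * (LINT s|unit_interval. (if s \<le> y then 1 else 0) * (1 - s) powr (p - 1)) \<le>
      exp (- c * w) * ((1 + w * y) powr (1 / p) * (1 + w / (p + 1)) powr (1 / q))"
    and \<gamma>: "\<And>j. j \<in> {1..d} \<Longrightarrow> 0 < \<gamma> j \<and> \<gamma> j \<le> 1"
    and a: "\<And>k. k \<in> {1..N} \<Longrightarrow> 0 \<le> a k"
    and x: "\<And>k. k \<in> {1..N} \<Longrightarrow> x k \<in> unit_cube {1..d}"
    and \<epsilon>: "0 \<le> \<epsilon>"
    and err: "\<And>f. f \<in> unit_ball (ereal q) \<gamma> d \<Longrightarrow>
      \<bar>cube_integral d f - quadrature N a x f\<bar> \<le> \<epsilon> * (\<Prod>j=1..d. 1 + \<gamma> j powr (p / 2) / (p + 1)) powr (1 / p)"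
  shows "(1 - \<epsilon>) * exp (c * (\<Sum>j=1..d. \<gamma> j powr (p / 2))) \<le> (1 + \<epsilon>) * real N"
proof -
  define w where "w = (\<lambda>j. \<gamma> j powr (p / 2))"
  define P where "P = (\<Prod>j=1..d. 1 + w j / (p + 1))"
  define E where "E = P powr (1 / p)"
  have w: "0 \<le> w j" "w j \<le> 1" if "j \<in> {1..d}" for j
    using \<gamma>[OF that] p by (auto simp: w_def powr_le1)
  have \<gamma>': "0 < \<gamma> j" if "j \<in> {1..d}" for j using \<gamma>[OF that] by simp
  have w_eq: "w j = \<gamma> j powr (p / 2)" for j by (simp add: w_def)
  have P: "1 \<le> P"
    unfolding P_def using w p by (intro prod_ge_1) auto
  have E: "0 < E" using P by (simp add: E_def)
  have pq: "(p - 1) * q = p" using q conj by (rule conj_exponent_mult)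
  have EP: "E * P powr (1 / q) = P"
    using P conj unfolding E_def powr_add[symmetric] by simp
  have err_E: "\<bar>cube_integral d f - quadrature N a x f\<bar> \<le> \<epsilon> * E" if "f \<in> unit_ball (ereal q) \<gamma> d" for f
    using err[OF that] by (simp add: E_def P_def w_def)
  \<comment> \<open>The error of the empty rule is the integral itself, so \<open>E\<close> bounds
    the integral over the unit ball.\<close>
  have init: "\<bar>cube_integral d f - quadrature 0 a x f\<bar> \<le> E" if "f \<in> unit_ball (ereal q) \<gamma> d" for f
  proof (rule error_le_finite[OF q conj \<gamma>' that _ E])
    have "E powr p = P" using P p by (simp add: E_def powr_powr)
    then show "disc_norm_pow p \<gamma> d (discrepancy 0 a x) \<le> E powr p"
      using p by (simp add: disc_norm_pow_initial P_def w_def)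
  qed auto
  \<comment> \<open>The equality case of Hoelder's inequality against \<open>1 - s\<close>: on the
    unit interval both \<open>\<phi> j s powr q\<close> and \<open>(1 - s) * \<phi> j s\<close>
    equal \<open>(1 - s) powr p\<close>. Hence \<open>P\<close> is at once the integral of
    \<open>h\<close> and the \<open>q\<close>-th power of its norm.\<close>
  define \<phi> where "\<phi> = (\<lambda>(_::nat) s::real. if s \<le> 1 then (1 - s) powr (p - 1) else 0)"
  define h where "h = tensor_fun d 1 w \<phi>"
  have \<phi>_meas: "\<phi> j \<in> borel_measurable borel" for j
    unfolding \<phi>_def by measurable
  have \<phi>_bounds: "0 \<le> \<phi> j t \<and> \<phi> j t \<le> 1" if "0 \<le> t" "t \<le> 1" for j t
    using that p by (auto simp: \<phi>_def intro: powr_le1)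
  have \<phi>q: "(LINT s|unit_interval. \<phi> j s powr q) = 1 / (p + 1)" for j
  proof -
    have "(LINT s|unit_interval. \<phi> j s powr q) = (LINT s|unit_interval. (1 - s) powr p)"
      by (intro Bochner_Integration.integral_cong refl) (auto simp: \<phi>_def powr_powr pq)
    then show ?thesis using p by (simp add: integral_one_minus_powr)
  qed
  have \<phi>1: "(LINT s|unit_interval. (1 - s) * \<phi> j s) = 1 / (p + 1)" for j
  proof -
    have "(LINT s|unit_interval. (1 - s) * \<phi> j s) = (LINT s|unit_interval. (1 - s) powr p)"
      by (intro Bochner_Integration.integral_cong refl)
         (auto simp: \<phi>_def powr_mult_base)
    then show ?thesis using p by (simp add: integral_one_minus_powr)
  qed
  have "cube_integral d h = P"
    unfolding h_def by (subst cube_integral_tensor[OF \<phi>_meas \<phi>_bounds w(1)]) (auto simp: \<phi>1 P_def)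
  moreover have "\<bar>cube_integral d h - quadrature N a x h\<bar> \<le> \<epsilon> * E * P powr (1 / q)"
    using tensor_fun_error[where w = w, OF \<phi>_meas \<phi>_bounds q conj \<gamma>' w_eq err_E]
    by (simp add: h_def \<phi>q P_def)
  ultimately have "P - quadrature N a x h \<le> \<epsilon> * (E * P powr (1 / q))"
    by (simp add: mult.assoc)
  then have lower: "(1 - \<epsilon>) * P \<le> quadrature N a x h"
    unfolding EP by (simp add: algebra_simps)
  have node: "a k * h (x k) \<le> (1 + \<epsilon>) * P * exp (- c * (\<Sum>j=1..d. w j))" if k: "k \<in> {1..N}" for k
  proof -
    define y where "y = x k"
    have y: "0 \<le> y j" "y j \<le> 1" if "j \<in> {1..d}" for j
      using unit_cubeD[OF x[OF k] that] by (auto simp: y_def)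
    \<comment> \<open>The derivative of \<open>min(s, y j)\<close>. The resulting \<open>S\<close>
      represents evaluation at \<open>y\<close>, and both \<open>S y\<close> and the
      \<open>q\<close>-th power of its norm equal \<open>Q\<close>.\<close>
    define \<psi> where "\<psi> = (\<lambda>j s::real. if s \<le> y j then 1 else (0::real))"
    define S where "S = tensor_fun d 1 w \<psi>"
    define Q where "Q = (\<Prod>j=1..d. 1 + w j * y j)"
    have Q: "1 \<le> Q"
      unfolding Q_def using w y by (intro prod_ge_1) auto
    have \<psi>_meas: "\<psi> j \<in> borel_measurable borel" for j
      unfolding \<psi>_def by measurable
    have \<psi>_bounds: "0 \<le> \<psi> j t \<and> \<psi> j t \<le> 1" for j t
      by (auto simp: \<psi>_def)
    have \<psi>q: "(LINT s|unit_interval. \<psi> j s powr q) = y j" if "j \<in> {1..d}" for j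
    proof -
      have "(LINT s|unit_interval. \<psi> j s powr q) = (LINT s|unit_interval. (if s \<le> y j then 1 else 0))"
        by (intro Bochner_Integration.integral_cong refl) (auto simp: \<psi>_def)
      then show ?thesis using integral_indicator_le y[OF that] by simp
    qed
    have norm: "(\<Prod>j=1..d. 1 + w j * (LINT s|unit_interval. \<psi> j s powr q)) = Q"
      unfolding Q_def by (intro prod.cong refl) (simp add: \<psi>q)
    have "\<bar>cube_integral d S - quadrature N a x S\<bar> \<le> \<epsilon> * E * Q powr (1 / q)"
      unfolding S_def norm[symmetric]
      by (rule tensor_fun_error[where w = w and \<phi> = \<psi>, OF \<psi>_meas \<psi>_bounds q conj \<gamma>' w_eq err_E])
    moreover have "\<bar>cube_integral d S - quadrature 0 a x S\<bar> \<le> E * Q powr (1 / q)"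
      unfolding S_def norm[symmetric]
      by (rule tensor_fun_error[where w = w and \<phi> = \<psi>, OF \<psi>_meas \<psi>_bounds q conj \<gamma>' w_eq init])
    ultimately have A_le: "quadrature N a x S \<le> (1 + \<epsilon>) * E * Q powr (1 / q)"
      by (simp add: quadrature_def algebra_simps)
    have S_nonneg: "0 \<le> S z" for z
      unfolding S_def tensor_fun_def using w \<psi>_bounds
      by (auto intro!: prod_nonneg add_nonneg_nonneg mult_nonneg_nonneg integral_nonneg_AE)
    have Sy: "S y = Q"
    proof -
      have "(LINT s|unit_interval. (if s \<le> y j then 1 else 0) * \<psi> j s) = y j" if "j \<in> {1..d}" for j
      proof -
        have "(LINT s|unit_interval. (if s \<le> y j then 1 else 0) * \<psi> j s) =
            (LINT s|unit_interval. (if s \<le> y j then 1 else 0))"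
          by (intro Bochner_Integration.integral_cong refl) (auto simp: \<psi>_def)
        then show ?thesis using integral_indicator_le y[OF that] by simp
      qed
      then show ?thesis
        unfolding S_def tensor_fun_def Q_def by (auto intro!: prod.cong)
    qed
    \<comment> \<open>The place where positivity of the rule is used: all other terms of the
      quadrature sum are nonnegative.\<close>
    have "a k * Q \<le> quadrature N a x S"
      unfolding quadrature_def Sy[symmetric] y_def
      using k a S_nonneg by (intro member_le_sum) auto
    with A_le have aQ: "a k * Q \<le> (1 + \<epsilon>) * E * Q powr (1 / q)" by simp
    have "h y = (\<Prod>j=1..d. 1 + w j * (LINT s|unit_interval. (if s \<le> y j then 1 else 0) * (1 - s) powr (p - 1)))"
      unfolding h_def tensor_fun_def mult_1
      by (intro prod.cong refl arg_cong[where f = "\<lambda>z. 1 + w _ * z"] Bochner_Integration.integral_cong)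
         (auto simp: \<phi>_def)
    also have "\<dots> \<le> (\<Prod>j=1..d. exp (- c * w j) * ((1 + w j * y j) powr (1 / p) * (1 + w j / (p + 1)) powr (1 / q)))"
    proof (intro prod_mono conjI gap)
      show "0 \<le> 1 + w j * (LINT s|unit_interval. (if s \<le> y j then 1 else 0) * (1 - s) powr (p - 1))"
        if "j \<in> {1..d}" for j
        using w[OF that] by (intro add_nonneg_nonneg mult_nonneg_nonneg integral_nonneg_AE AE_I2) auto
    qed (use w y in auto)
    also have "\<dots> = exp (- c * (\<Sum>j=1..d. w j)) * (Q powr (1 / p) * P powr (1 / q))"
      by (simp add: prod.distrib Q_def P_def prod_powr_distrib exp_sum[symmetric] sum_distrib_left sum_negf)
    finally have hy: "h y \<le> exp (- c * (\<Sum>j=1..d. w j)) * (Q powr (1 / p) * P powr (1 / q))" .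
    have "a k * h y \<le> a k * (exp (- c * (\<Sum>j=1..d. w j)) * (Q powr (1 / p) * P powr (1 / q)))"
      using hy a[OF k] by (rule mult_left_mono)
    also have "\<dots> = (a k * Q) * (Q powr (- (1 / q)) * P powr (1 / q) * exp (- c * (\<Sum>j=1..d. w j)))"
    proof -
      \<comment> \<open>Splits one full factor \<open>Q\<close> off \<open>Q powr (1 / p)\<close>,
        so that the bound \<open>aQ\<close> on \<open>a k * Q\<close> applies; the remaining powers
        of \<open>Q\<close> cancel against those of the norm.\<close>
      have "1 / p = 1 + - (1 / q)" using conj by simp
      then have "Q powr (1 / p) = Q * Q powr (- (1 / q))"
        using Q by (simp only: powr_add) simp
      then show ?thesis by (simp only: mult_ac)
    qed
    also have "\<dots> \<le> ((1 + \<epsilon>) * E * Q powr (1 / q)) *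
        (Q powr (- (1 / q)) * P powr (1 / q) * exp (- c * (\<Sum>j=1..d. w j)))"
      using aQ by (rule mult_right_mono) simp
    also have "\<dots> = (1 + \<epsilon>) * (E * P powr (1 / q)) * (Q powr (1 / q) * Q powr (- (1 / q))) * exp (- c * (\<Sum>j=1..d. w j))"
      by (simp only: mult_ac)
    also have "\<dots> = (1 + \<epsilon>) * P * exp (- c * (\<Sum>j=1..d. w j))"
      unfolding EP powr_add[symmetric] using Q by simp
    finally show ?thesis by (simp add: y_def)
  qed
  have "quadrature N a x h \<le> (\<Sum>k=1..N. (1 + \<epsilon>) * P * exp (- c * (\<Sum>j=1..d. w j)))"
    unfolding quadrature_def by (rule sum_mono) (rule node)
  with lower have "(1 - \<epsilon>) * P \<le> (\<Sum>k=1..N. (1 + \<epsilon>) * P * exp (- c * (\<Sum>j=1..d. w j)))"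
    by (rule order_trans)
  also have "\<dots> = ((1 + \<epsilon>) * real N * exp (- c * (\<Sum>j=1..d. w j))) * P"
    by simp
  finally have "1 - \<epsilon> \<le> (1 + \<epsilon>) * real N * exp (- c * (\<Sum>j=1..d. w j))"
    using P by simp
  then have "(1 - \<epsilon>) * exp (c * (\<Sum>j=1..d. w j)) \<le>
      (1 + \<epsilon>) * real N * exp (- c * (\<Sum>j=1..d. w j)) * exp (c * (\<Sum>j=1..d. w j))"
    by (rule mult_right_mono) simp
  also have "\<dots> = (1 + \<epsilon>) * real N"
    by (simp add: mult.assoc exp_add[symmetric])
  finally show ?thesis by (simp add: w_def)
qed

lemma information_complexity_ge:
  fixes q p :: real
  assumes q: "1 < q" and conj: "1 / p + 1 / q = 1"
  shows "\<exists>c>0. \<forall>\<gamma> d. (\<forall>j\<in>{1..d}. 0 < \<gamma> j \<and> \<gamma> j \<le> 1) \<longrightarrow>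
    exp (c * (\<Sum>j=1..d. \<gamma> j powr (p / 2))) \<le> 7 * real (information_complexity (ereal q) \<gamma> (1 / 2) d)"
proof -
  have qp: "conj_exponents (ereal q) p"
    using q conj by (simp add: conj_exponents_def)
  have p: "1 < p" using q conj by (rule conj_exponent_gt_1)
  obtain c where c: "0 < c" and gap: "\<forall>w y. 0 \<le> w \<and> w \<le> 1 \<and> 0 \<le> y \<and> y \<le> 1 \<longrightarrow>
      1 + w * (LINT s|unit_interval. (if s \<le> y then 1 else 0) * (1 - s) powr (p - 1)) \<le>
      exp (- c * w) * ((1 + w * y) powr (1 / p) * (1 + w / (p + 1)) powr (1 / q))"
    using hoelder_gap[OF p q conj] by (elim exE conjE) (rule that)
  have main: "exp (c * (\<Sum>j=1..d. \<gamma> j powr (p / 2))) \<le> 7 * real (information_complexity (ereal q) \<gamma> (1 / 2) d)"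
    if \<gamma>: "\<forall>j\<in>{1..d}. 0 < \<gamma> j \<and> \<gamma> j \<le> 1" for \<gamma> :: "nat \<Rightarrow> real" and d
  proof -
    define N where "N = information_complexity (ereal q) \<gamma> (1 / 2) d"
    define P where "P = (\<Prod>j=1..d. 1 + \<gamma> j powr (p / 2) / (p + 1))"
    define E where "E = P powr (1 / p)"
    have P: "1 \<le> P" unfolding P_def using p by (intro prod_ge_1) auto
    have E: "0 < E" using P by (simp add: E_def)
    have EP: "E powr p = P" using P p by (simp add: E_def powr_powr)
    have "minimal_error (ereal q) \<gamma> N d \<le> ereal (1 / 2) * initial_error (ereal q) \<gamma> d"
      using \<gamma> unfolding N_def by (intro information_complexity_le(2)[OF qp]) auto
    also have "\<dots> \<le> ereal (1 / 2) * ereal E"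
    proof (rule ereal_mult_left_mono)
      show "initial_error (ereal q) \<gamma> d \<le> ereal E"
        unfolding initial_error_def
      proof (rule SUP_least)
        fix f assume f: "f \<in> unit_ball (ereal q) \<gamma> d"
        have "\<bar>cube_integral d f - quadrature 0 (\<lambda>_. 0) (\<lambda>_ _. 0) f\<bar> \<le> E"
          using \<gamma> p EP by (intro error_le_finite[OF q conj _ f _ E]) (auto simp: disc_norm_pow_initial P_def)
        then show "ereal \<bar>cube_integral d f\<bar> \<le> ereal E" by (simp add: quadrature_def)
      qed
    qed auto
    \<comment> \<open>The minimal error is an infimum that need not be attained. Enlarging 1/2 to
      3/4 leaves room for an actual rule; the constant 7 is then
      \<open>(1 + 3/4) / (1 - 3/4)\<close>.\<close>
    also have "\<dots> < ereal (3 / 4 * E)" using E by simp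
    finally obtain a x where ax: "(a, x) \<in> positive_rules N d"
      and wce: "worst_case_error (ereal q) \<gamma> d (quadrature N a x) < ereal (3 / 4 * E)"
      unfolding minimal_error_def by (auto simp: INF_less_iff)
    have err: "\<bar>cube_integral d f - quadrature N a x f\<bar> \<le> 3 / 4 * E" if "f \<in> unit_ball (ereal q) \<gamma> d" for f
    proof -
      have "ereal \<bar>cube_integral d f - quadrature N a x f\<bar> \<le> worst_case_error (ereal q) \<gamma> d (quadrature N a x)"
        unfolding worst_case_error_def using that by (rule SUP_upper)
      also note wce
      finally show ?thesis by simp
    qed
    have "(1 - 3 / 4) * exp (c * (\<Sum>j=1..d. \<gamma> j powr (p / 2))) \<le> (1 + 3 / 4) * real N"
    proof (rule positive_rule_lower_bound[OF q conj p gap[rule_format]])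
      show "0 \<le> a k" "x k \<in> unit_cube {1..d}" if "k \<in> {1..N}" for k
        using ax that subsetD[OF half_open_cube_subset[of d]] by (auto simp: positive_rules_def)
    qed (use \<gamma> err in \<open>auto simp: E_def P_def\<close>)
    then show ?thesis by (simp add: N_def)
  qed
  show ?thesis
    by (intro exI[of _ c] conjI allI impI c main)
qed

section \<open>Tractability\<close>

definition weight_sum :: "real \<Rightarrow> (nat \<Rightarrow> real) \<Rightarrow> nat \<Rightarrow> real" where
  "weight_sum p \<gamma> d = (\<Sum>j=1..d. \<gamma> j powr (p / 2))"

context
  fixes \<gamma> :: "nat \<Rightarrow> real"
  assumes weights: "\<And>j. 1 \<le> j \<Longrightarrow> 0 < \<gamma> j \<and> \<gamma> j \<le> 1"
begin

lemma weight_sum_nonneg: "0 \<le> weight_sum p \<gamma> d"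
  by (auto simp: weight_sum_def intro: sum_nonneg)

lemma weight_sum_le: "0 \<le> p \<Longrightarrow> weight_sum p \<gamma> d \<le> real d"
proof -
  assume p: "0 \<le> p"
  have "weight_sum p \<gamma> d \<le> (\<Sum>j=1..d. 1)"
    unfolding weight_sum_def
  proof (rule sum_mono)
    fix j assume "j \<in> {1..d}"
    then show "\<gamma> j powr (p / 2) \<le> 1"
      using weights[of j] p by (intro powr_le1) auto
  qed
  then show ?thesis by simp
qed

lemma weight_sum_lessThan: "weight_sum p \<gamma> d = (\<Sum>j<d. \<gamma> (Suc j) powr (p / 2))"
  by (simp add: weight_sum_def sum.atLeast1_atMost_eq)

lemma complexity_upper:
  assumes "conj_exponents q p" "0 < \<epsilon>" "\<epsilon> < 1"
  shows "1 \<le> information_complexity q \<gamma> \<epsilon> d"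
    "real (information_complexity q \<gamma> \<epsilon> d) \<le> 2 * \<epsilon> powr (- (2 * p)) * exp (2 * weight_sum p \<gamma> d)"
  using information_complexity_le[OF assms(1) _ assms(2,3), of d \<gamma>] weights
  by (auto simp: weight_sum_def)

lemma complexity_lower:
  fixes q p :: real
  assumes "1 < q" "1 / p + 1 / q = 1"
  obtains c where "0 < c"
    "\<And>d. exp (c * weight_sum p \<gamma> d) \<le> 7 * real (information_complexity (ereal q) \<gamma> (1 / 2) d)"
proof -
  obtain c where c: "c > 0" and le: "\<forall>\<gamma> d. (\<forall>j\<in>{1..d}. 0 < \<gamma> j \<and> \<gamma> j \<le> 1) \<longrightarrow>
    exp (c * (\<Sum>j=1..d. \<gamma> j powr (p / 2))) \<le> 7 * real (information_complexity (ereal q) \<gamma> (1 / 2) d)"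
    using information_complexity_ge[OF assms] by (elim exE conjE) (rule that)
  have "exp (c * weight_sum p \<gamma> d) \<le> 7 * real (information_complexity (ereal q) \<gamma> (1 / 2) d)" for d
    unfolding weight_sum_def using weights by (intro le[rule_format]) auto
  then show ?thesis by (rule that[OF c])
qed

lemma strongly_polynomially_tractableI:
  assumes qp: "conj_exponents q p" and sum: "summable (\<lambda>j. \<gamma> (Suc j) powr (p / 2))"
  shows "strongly_polynomially_tractable q \<gamma>"
proof -
  define T where "T = (\<Sum>j. \<gamma> (Suc j) powr (p / 2))"
  have T: "weight_sum p \<gamma> d \<le> T" for d
    unfolding weight_sum_lessThan T_def by (rule sum_le_suminf[OF sum]) auto
  have "real (information_complexity q \<gamma> \<epsilon> d) \<le> (2 * exp (2 * T)) * \<epsilon> powr (- (2 * p))"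
    if "\<epsilon> \<in> {0<..<1}" for \<epsilon> d
  proof -
    have "real (information_complexity q \<gamma> \<epsilon> d) \<le> 2 * \<epsilon> powr (- (2 * p)) * exp (2 * weight_sum p \<gamma> d)"
      using that by (intro complexity_upper(2)[OF qp]) auto
    also have "\<dots> \<le> 2 * \<epsilon> powr (- (2 * p)) * exp (2 * T)"
      using T[of d] by (intro mult_left_mono) auto
    finally show ?thesis by (simp add: mult_ac)
  qed
  then show ?thesis
    unfolding strongly_polynomially_tractable_def
    using conj_exponents_bounds(2)[OF qp]
    by (intro exI[of _ "2 * exp (2 * T)"] exI[of _ "2 * p"]) auto
qed

text \<open>At accuracy 1/2 the complexity is bounded in \<open>d\<close>, and by the exponential
  lower bound so are the partial sums.\<close>

lemma strongly_polynomially_tractableD: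
  fixes q p :: real
  assumes qp: "1 < q" "1 / p + 1 / q = 1" and spt: "strongly_polynomially_tractable (ereal q) \<gamma>"
  shows "summable (\<lambda>j. \<gamma> (Suc j) powr (p / 2))"
proof -
  obtain c where c: "0 < c" and lower:
    "\<And>d. exp (c * weight_sum p \<gamma> d) \<le> 7 * real (information_complexity (ereal q) \<gamma> (1 / 2) d)"
    using complexity_lower[OF qp] by blast
  obtain C \<sigma> where C: "C > 0" and
    le: "\<And>\<epsilon> d. \<epsilon> \<in> {0<..<1} \<Longrightarrow> d \<ge> 1 \<Longrightarrow> real (information_complexity (ereal q) \<gamma> \<epsilon> d) \<le> C * \<epsilon> powr (- \<sigma>)"
    using spt unfolding strongly_polynomially_tractable_def by blast
  define K where "K = 7 * (C * (1 / 2) powr (- \<sigma>))"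
  have K: "0 < K" using C by (simp add: K_def)
  have bound: "weight_sum p \<gamma> (Suc d) \<le> ln K / c" for d
  proof -
    have "exp (c * weight_sum p \<gamma> (Suc d)) \<le> K"
      using lower[of "Suc d"] le[of "1 / 2" "Suc d"] by (simp add: K_def)
    then have "c * weight_sum p \<gamma> (Suc d) \<le> ln K"
      using K by (simp add: ln_ge_iff)
    then show ?thesis using c by (simp add: pos_le_divide_eq mult.commute)
  qed
  show ?thesis
    using bound
    by (intro bounded_imp_summable[where B = "ln K / c"]) (auto simp: weight_sum_lessThan lessThan_Suc_atMost)
qed

lemma polynomially_tractableI:
  assumes qp: "conj_exponents q p"
    and lim: "limsup (\<lambda>d. ereal (1 / ln (real d) * weight_sum p \<gamma> d)) < \<infinity>"
  shows "polynomially_tractable q \<gamma>"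
proof -
  have p: "1 \<le> p" using conj_exponents_bounds(2)[OF qp] .
  obtain B0 where B0: "limsup (\<lambda>d. ereal (1 / ln (real d) * weight_sum p \<gamma> d)) < ereal B0"
    using lim less_PInf_Ex_of_nat by (metis less_irrefl)
  \<comment> \<open>Made nonnegative because \<open>2 * B\<close> becomes the exponent of
    \<open>d\<close>, which must not be negative.\<close>
  define B where "B = max B0 0"
  have "eventually (\<lambda>d. ereal (1 / ln (real d) * weight_sum p \<gamma> d) < ereal B0) sequentially"
    using B0 by (rule Limsup_lessD)
  then obtain D where D: "\<And>d. D \<le> d \<Longrightarrow> 1 / ln (real d) * weight_sum p \<gamma> d < B0"
    by (auto simp: eventually_sequentially)
  \<comment> \<open>For \<open>d = 1\<close> the quotient by \<open>ln (real d)\<close> is a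
    division by zero and carries no information. This case and all \<open>d < D\<close> are absorbed
    into the additive constant, since every summand is at most 1.\<close>
  have bound: "weight_sum p \<gamma> d \<le> B * ln (real d) + (real D + 2)" if d: "1 \<le> d" for d
  proof (cases "D \<le> d \<and> 2 \<le> d")
    case True
    then have "0 < ln (real d)" by simp
    then have "weight_sum p \<gamma> d < B0 * ln (real d)"
      using D[of d] True by (simp add: field_simps)
    also have "\<dots> \<le> B * ln (real d)"
      using \<open>0 < ln (real d)\<close> by (intro mult_right_mono) (auto simp: B_def)
    finally show ?thesis by simp
  next
    case False
    then have "weight_sum p \<gamma> d \<le> real D + 2"
      using weight_sum_le[of p d] p by auto
    moreover have "0 \<le> B * ln (real d)" using d by (simp add: B_def)
    ultimately show ?thesis by simp
  qed
  have "real (information_complexity q \<gamma> \<epsilon> d) \<le>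
      (2 * exp (2 * (real D + 2))) * real d powr (2 * B) * \<epsilon> powr (- (2 * p))"
    if "\<epsilon> \<in> {0<..<1}" and d: "1 \<le> d" for \<epsilon> d
  proof -
    have "real (information_complexity q \<gamma> \<epsilon> d) \<le> 2 * \<epsilon> powr (- (2 * p)) * exp (2 * weight_sum p \<gamma> d)"
      using that by (intro complexity_upper(2)[OF qp]) auto
    also have "\<dots> \<le> 2 * \<epsilon> powr (- (2 * p)) * exp (2 * (B * ln (real d) + (real D + 2)))"
      using bound[OF d] by (intro mult_left_mono) auto
    also have "exp (2 * (B * ln (real d) + (real D + 2))) = real d powr (2 * B) * exp (2 * (real D + 2))"
      using d by (simp add: powr_def exp_add[symmetric] algebra_simps)
    finally show ?thesis by (simp add: mult_ac)
  qed
  then show ?thesis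
    unfolding polynomially_tractable_def using p
    by (intro exI[of _ "2 * exp (2 * (real D + 2))"] exI[of _ "2 * p"] exI[of _ "2 * B"]) (auto simp: B_def)
qed

text \<open>Logarithms of the two bounds at accuracy 1/2. The affine form in \<open>ln d\<close>
  serves both the limsup condition and the vanishing of the averages.\<close>

lemma polynomially_tractable_weight_sum:
  fixes q p :: real
  assumes qp: "1 < q" "1 / p + 1 / q = 1" and pt: "polynomially_tractable (ereal q) \<gamma>"
  obtains A B where "0 \<le> A" "0 \<le> B" "\<And>d. 1 \<le> d \<Longrightarrow> weight_sum p \<gamma> d \<le> A + B * ln (real d)"
proof -
  obtain c where c: "0 < c" and lower:
    "\<And>d. exp (c * weight_sum p \<gamma> d) \<le> 7 * real (information_complexity (ereal q) \<gamma> (1 / 2) d)"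
    using complexity_lower[OF qp] by blast
  obtain C \<sigma> \<tau> where C: "C > 0" "\<tau> \<ge> 0" and
    le: "\<And>\<epsilon> d. \<epsilon> \<in> {0<..<1} \<Longrightarrow> d \<ge> 1 \<Longrightarrow>
      real (information_complexity (ereal q) \<gamma> \<epsilon> d) \<le> C * real d powr \<tau> * \<epsilon> powr (- \<sigma>)"
    using pt unfolding polynomially_tractable_def by blast
  define K where "K = 7 * (C * (1 / 2) powr (- \<sigma>))"
  have K: "0 < K" using C by (simp add: K_def)
  have "weight_sum p \<gamma> d \<le> \<bar>ln K\<bar> / c + \<tau> / c * ln (real d)" if d: "1 \<le> d" for d
  proof -
    have "exp (c * weight_sum p \<gamma> d) \<le> K * real d powr \<tau>"
      using lower[of d] le[of "1 / 2" d] d by (simp add: K_def mult_ac)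
    then have "c * weight_sum p \<gamma> d \<le> ln (K * real d powr \<tau>)"
      using K d by (simp add: ln_ge_iff)
    also have "\<dots> = ln K + \<tau> * ln (real d)"
      using K d by (simp add: ln_mult ln_powr)
    also have "\<dots> \<le> \<bar>ln K\<bar> + \<tau> * ln (real d)" by simp
    finally have "weight_sum p \<gamma> d \<le> (\<bar>ln K\<bar> + \<tau> * ln (real d)) / c"
      using c by (simp add: pos_le_divide_eq mult.commute)
    then show ?thesis by (simp add: add_divide_distrib)
  qed
  then show ?thesis
    using c C by (intro that[of "\<bar>ln K\<bar> / c" "\<tau> / c"]) auto
qed

lemma polynomially_tractableD:
  fixes q p :: real
  assumes qp: "1 < q" "1 / p + 1 / q = 1" and pt: "polynomially_tractable (ereal q) \<gamma>"
  shows "limsup (\<lambda>d. ereal (1 / ln (real d) * weight_sum p \<gamma> d)) < \<infinity>"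
proof -
  obtain A B where AB: "0 \<le> A" "0 \<le> B" "\<And>d. 1 \<le> d \<Longrightarrow> weight_sum p \<gamma> d \<le> A + B * ln (real d)"
    using polynomially_tractable_weight_sum[OF qp pt] by blast
  have "limsup (\<lambda>d. ereal (1 / ln (real d) * weight_sum p \<gamma> d)) \<le> ereal (A + B)"
  proof (rule Limsup_bounded)
    show "eventually (\<lambda>d. ereal (1 / ln (real d) * weight_sum p \<gamma> d) \<le> ereal (A + B)) sequentially"
      \<comment> \<open>From 3 on \<open>ln (real d)\<close> is at least 1, so that the additive
        constant \<open>A\<close> is dominated by \<open>A * ln (real d)\<close>.\<close>
      using eventually_ge_at_top[of "3::nat"]
    proof eventually_elim
      case (elim d)
      have "exp 1 \<le> real d" using exp_le elim by linarith
      then have ln: "1 \<le> ln (real d)" using elim by (simp add: ln_ge_iff)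
      have "weight_sum p \<gamma> d \<le> A * 1 + B * ln (real d)" using AB(3)[of d] elim by simp
      also have "\<dots> \<le> A * ln (real d) + B * ln (real d)"
        using ln AB by (intro add_right_mono mult_left_mono)
      finally have "weight_sum p \<gamma> d \<le> (A + B) * ln (real d)" by (simp add: distrib_right)
      then show ?case using ln by (simp add: pos_divide_le_eq)
    qed
  qed
  then show ?thesis by (rule le_less_trans) simp
qed

text \<open>With \<open>T = d + 1 / \<epsilon>\<close> the logarithm of the complexity is at most a
  constant plus \<open>2 * p * ln T\<close> plus twice the weight sum. The first two are
  \<open>o(T)\<close> however \<open>d\<close> and \<epsilon> vary, and the last is a small multiple
  of \<open>d \<le> T\<close> up to a constant.\<close>

lemma weakly_tractableI:
  assumes qp: "conj_exponents q p"
    and lim: "(\<lambda>d. 1 / real d * weight_sum p \<gamma> d) \<longlonglongrightarrow> 0"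
  shows "weakly_tractable q \<gamma>"
  unfolding weakly_tractable_def
proof (rule tendstoI)
  fix \<eta> :: real assume \<eta>: "0 < \<eta>"
  have p: "1 \<le> p" using conj_exponents_bounds(2)[OF qp] .
  \<comment> \<open>Doubled in the exponent, \<open>\<eta> / 8\<close> contributes
    \<open>\<eta> / 4\<close>; together with \<open>\<eta> / 2\<close> for the lower-order terms
    this stays below \<eta>.\<close>
  have "eventually (\<lambda>d. 1 / real d * weight_sum p \<gamma> d < \<eta> / 8) sequentially"
    using lim \<eta> by (intro order_tendstoD) auto
  then obtain D where D: "\<And>d. D \<le> d \<Longrightarrow> 1 / real d * weight_sum p \<gamma> d < \<eta> / 8"
    by (auto simp: eventually_sequentially)
  have bound: "weight_sum p \<gamma> d \<le> \<eta> / 8 * real d + real D" if d: "1 \<le> d" for d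
  proof (cases "D \<le> d")
    case True
    then show ?thesis using D[of d] d by (simp add: field_simps)
  next
    case False
    then have "weight_sum p \<gamma> d \<le> real D" using weight_sum_le[of p d] p by simp
    then show ?thesis using \<eta> by (simp add: add_increasing)
  qed
  define K where "K = ln 2 + 2 * real D"
  have "((\<lambda>T. K * (1 / T) + 2 * p * (ln T / T)) \<longlongrightarrow> K * 0 + 2 * p * 0) at_top"
    by (intro tendsto_intros ln_x_over_x_tendsto_0 tendsto_divide_0[OF tendsto_const] filterlim_at_top_imp_at_infinity filterlim_ident)
  then have ev: "eventually (\<lambda>T. K * (1 / T) + 2 * p * (ln T / T) < \<eta> / 2) at_top"
    using \<eta> by (intro order_tendstoD) auto
  let ?T = "\<lambda>(d::nat, \<epsilon>::real). real d + 1 / \<epsilon>"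
  have "dist (ln (real (information_complexity q \<gamma> \<epsilon> d)) / (real d + 1 / \<epsilon>)) 0 < \<eta>"
    if "K * (1 / (real d + 1 / \<epsilon>)) + 2 * p * (ln (real d + 1 / \<epsilon>) / (real d + 1 / \<epsilon>)) < \<eta> / 2"
      and d: "1 \<le> d" and \<epsilon>: "0 < \<epsilon>" "\<epsilon> < 1" for d \<epsilon>
  proof -
    define T where "T = real d + 1 / \<epsilon>"
    define N where "N = information_complexity q \<gamma> \<epsilon> d"
    have T: "0 < T" "1 / \<epsilon> \<le> T" "real d \<le> T" using d \<epsilon> by (auto simp: T_def add_pos_pos)
    have N: "1 \<le> N" "real N \<le> 2 * \<epsilon> powr (- (2 * p)) * exp (2 * weight_sum p \<gamma> d)"
      using complexity_upper[OF qp \<epsilon>, of d] by (auto simp: N_def)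
    have "ln (real N) \<le> ln (2 * \<epsilon> powr (- (2 * p)) * exp (2 * weight_sum p \<gamma> d))"
      using N \<epsilon> by (intro ln_mono) auto
    also have "\<dots> = ln 2 + 2 * p * ln (1 / \<epsilon>) + 2 * weight_sum p \<gamma> d"
      using \<epsilon> by (simp add: ln_mult ln_powr ln_div)
    also have "\<dots> \<le> ln 2 + 2 * p * ln T + 2 * (\<eta> / 8 * T + real D)"
    proof (intro add_mono mult_left_mono order_refl)
      show "ln (1 / \<epsilon>) \<le> ln T" using T \<epsilon> by (intro ln_mono) auto
      have "\<eta> / 8 * real d \<le> \<eta> / 8 * T" using T \<eta> by (intro mult_left_mono) auto
      then show "weight_sum p \<gamma> d \<le> \<eta> / 8 * T + real D"
        using bound[OF d] by linarith
    qed (use p in auto)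
    finally have "ln (real N) \<le> K + 2 * p * ln T + \<eta> / 4 * T"
      by (simp add: K_def mult.commute)
    then have "ln (real N) / T \<le> (K + 2 * p * ln T + \<eta> / 4 * T) / T"
      using T by (intro divide_right_mono) auto
    also have "\<dots> = K * (1 / T) + 2 * p * (ln T / T) + \<eta> / 4"
      using T by (simp add: add_divide_distrib)
    also have "\<dots> < \<eta>" using that(1) \<eta> by (simp add: T_def)
    finally have "ln (real N) / T < \<eta>" .
    moreover have "0 \<le> ln (real N) / T" using N T by simp
    ultimately show ?thesis by (simp add: N_def T_def del: abs_divide)
  qed
  then show "\<forall>\<^sub>F z in inf (filtercomap ?T at_top) (principal ({1..} \<times> {0<..<1})).
      dist (case z of (d, \<epsilon>) \<Rightarrow> ln (real (information_complexity q \<gamma> \<epsilon> d)) / (real d + 1 / \<epsilon>)) 0 < \<eta>"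
    unfolding eventually_inf_principal eventually_filtercomap
    by (intro exI[of _ "\<lambda>T. K * (1 / T) + 2 * p * (ln T / T) < \<eta> / 2"] conjI ev) auto
qed

text \<open>The two-parameter limit is restricted to the path with \<epsilon> fixed at 1/2, along
  which the denominator is \<open>d + 2\<close>.\<close>

lemma weakly_tractableD:
  fixes q p :: real
  assumes qp: "1 < q" "1 / p + 1 / q = 1" and wt: "weakly_tractable (ereal q) \<gamma>"
  shows "(\<lambda>d. 1 / real d * weight_sum p \<gamma> d) \<longlonglongrightarrow> 0"
proof -
  obtain c where c: "0 < c" and lower:
    "\<And>d. exp (c * weight_sum p \<gamma> d) \<le> 7 * real (information_complexity (ereal q) \<gamma> (1 / 2) d)"
    using complexity_lower[OF qp] by blast
  define N where "N = (\<lambda>d. information_complexity (ereal q) \<gamma> (1 / 2) d)"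
  have qp': "conj_exponents (ereal q) p"
    using qp by (simp add: conj_exponents_def)
  have N: "1 \<le> N d" for d
    unfolding N_def by (rule complexity_upper(1)[OF qp']) auto
  have "filterlim (\<lambda>d. 2 + real d) at_top sequentially"
    by (rule filterlim_tendsto_add_at_top[OF tendsto_const filterlim_real_sequentially])
  then have "filterlim (\<lambda>d. (d, 1 / 2)) (inf (filtercomap (\<lambda>(d, \<epsilon>). real d + 1 / \<epsilon>) at_top)
      (principal ({1..} \<times> {0<..<1}))) sequentially"
    unfolding filterlim_inf filterlim_principal filterlim_filtercomap_iff
    using eventually_ge_at_top[of "1::nat"]
    by (auto simp: o_def add.commute elim!: eventually_mono)
  from filterlim_compose[OF wt[unfolded weakly_tractable_def] this]
  have "(\<lambda>d. ln (real (N d)) / (real d + 2)) \<longlonglongrightarrow> 0"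
    by (simp add: N_def)
  then have "(\<lambda>d. (ln 7 * (1 / real d) + 3 * (ln (real (N d)) / (real d + 2))) / c) \<longlonglongrightarrow> (ln 7 * 0 + 3 * 0) / c"
    using c by (intro tendsto_intros lim_1_over_n) auto
  then have lim: "(\<lambda>d. (ln 7 * (1 / real d) + 3 * (ln (real (N d)) / (real d + 2))) / c) \<longlonglongrightarrow> 0"
    by simp
  show ?thesis
  proof (rule tendsto_sandwich[OF _ _ tendsto_const lim])
    show "\<forall>\<^sub>F d in sequentially. 0 \<le> 1 / real d * weight_sum p \<gamma> d"
      using weight_sum_nonneg by auto
    show "\<forall>\<^sub>F d in sequentially. 1 / real d * weight_sum p \<gamma> d \<le>
        (ln 7 * (1 / real d) + 3 * (ln (real (N d)) / (real d + 2))) / c"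
      using eventually_ge_at_top[of "1::nat"]
    proof eventually_elim
      case (elim d)
      have "c * weight_sum p \<gamma> d \<le> ln (7 * real (N d))"
        using lower[of d] N[of d] by (simp add: ln_ge_iff N_def)
      then have "c * weight_sum p \<gamma> d \<le> ln 7 + ln (real (N d))"
        using N[of d] by (simp add: ln_mult)
      then have "c * weight_sum p \<gamma> d / real d \<le> (ln 7 + ln (real (N d))) / real d"
        by (intro divide_right_mono) auto
      also have "\<dots> = ln 7 * (1 / real d) + ln (real (N d)) / real d"
        by (simp add: add_divide_distrib)
      also have "ln (real (N d)) / real d \<le> 3 * (ln (real (N d)) / (real d + 2))"
      proof -
        \<comment> \<open>Exchanges the denominator \<open>d + 2\<close> of the path for
          \<open>d\<close>; the factor 3 is attained at \<open>d = 1\<close>.\<close>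
        have "1 / real d \<le> 3 / (real d + 2)" using elim by (simp add: field_simps)
        then have "ln (real (N d)) * (1 / real d) \<le> ln (real (N d)) * (3 / (real d + 2))"
          using N[of d] by (intro mult_left_mono) auto
        then show ?thesis by (simp add: mult.commute)
      qed
      finally have "c * (1 / real d * weight_sum p \<gamma> d) \<le> ln 7 * (1 / real d) + 3 * (ln (real (N d)) / (real d + 2))"
        by simp
      then show ?case using c by (simp add: pos_le_divide_eq mult.commute)
    qed
  qed
qed

section \<open>Convergence of the weights themselves\<close>

lemma weights_tendsto_0:
  assumes p: "0 < p" and lim: "(\<lambda>j. \<gamma> j powr (p / 2)) \<longlonglongrightarrow> 0"
  shows "\<gamma> \<longlonglongrightarrow> 0"
proof -
  have "(\<lambda>j. (\<gamma> j powr (p / 2)) powr (2 / p)) \<longlonglongrightarrow> 0 powr (2 / p)"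
    using p by (intro tendsto_powr'[OF lim tendsto_const]) auto
  then have "(\<lambda>j. (\<gamma> j powr (p / 2)) powr (2 / p)) \<longlonglongrightarrow> 0"
    by simp
  moreover have "\<forall>\<^sub>F j in sequentially. (\<gamma> j powr (p / 2)) powr (2 / p) = \<gamma> j"
    using eventually_ge_at_top[of "1::nat"]
  proof eventually_elim
    case (elim j)
    then show ?case using weights[of j] p by (simp add: powr_powr)
  qed
  ultimately show ?thesis by (rule Lim_transform_eventually)
qed

text \<open>For nonincreasing weights the last term of an average is its smallest, hence at most the
  average. Vanishing averages alone would still allow weights equal to 1 along a sparse sequence of
  coordinates.\<close>

lemma antimono_weights_tendsto_0:
  assumes p: "0 < p" and anti: "antimono_on {1..} \<gamma>"
    and lim: "(\<lambda>d. 1 / real d * weight_sum p \<gamma> d) \<longlonglongrightarrow> 0"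
  shows "\<gamma> \<longlonglongrightarrow> 0"
proof (rule weights_tendsto_0[OF p tendsto_sandwich[OF _ _ tendsto_const lim]])
  show "\<forall>\<^sub>F d in sequentially. \<gamma> d powr (p / 2) \<le> 1 / real d * weight_sum p \<gamma> d"
    using eventually_ge_at_top[of "1::nat"]
  proof eventually_elim
    case (elim d)
    have "(\<Sum>j=1..d. \<gamma> d powr (p / 2)) \<le> weight_sum p \<gamma> d"
      unfolding weight_sum_def
    proof (intro sum_mono powr_mono2)
      fix j assume "j \<in> {1..d}"
      then show "\<gamma> d \<le> \<gamma> j" using anti by (auto simp: monotone_on_def)
    qed (use p elim weights[of d] in auto)
    then show ?case using elim by (simp add: field_simps)
  qed
qed auto

lemma polynomially_tractable_imp_average:
  fixes q p :: real
  assumes qp: "1 < q" "1 / p + 1 / q = 1" and pt: "polynomially_tractable (ereal q) \<gamma>"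
  shows "(\<lambda>d. 1 / real d * weight_sum p \<gamma> d) \<longlonglongrightarrow> 0"
proof -
  obtain A B where AB: "\<And>d. 1 \<le> d \<Longrightarrow> weight_sum p \<gamma> d \<le> A + B * ln (real d)"
    using polynomially_tractable_weight_sum[OF qp pt] by blast
  have "(\<lambda>d. A * (1 / real d) + B * (ln (real d) / real d)) \<longlonglongrightarrow> A * 0 + B * 0"
    by (intro tendsto_intros lim_1_over_n lim_ln_over_n)
  then have lim: "(\<lambda>d. A * (1 / real d) + B * (ln (real d) / real d)) \<longlonglongrightarrow> 0" by simp
  show ?thesis
  proof (rule tendsto_sandwich[OF _ _ tendsto_const lim])
    show "\<forall>\<^sub>F d in sequentially. 0 \<le> 1 / real d * weight_sum p \<gamma> d"
      using weight_sum_nonneg by auto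
    show "\<forall>\<^sub>F d in sequentially. 1 / real d * weight_sum p \<gamma> d \<le> A * (1 / real d) + B * (ln (real d) / real d)"
      using eventually_ge_at_top[of "1::nat"]
    proof eventually_elim
      case (elim d)
      then show ?case
        using AB[of d] divide_right_mono[of "weight_sum p \<gamma> d" "A + B * ln (real d)" "real d"]
        by (simp add: add_divide_distrib)
    qed
  qed
qed

end

theorem corollary5:
  fixes q p :: real and \<gamma> :: "nat \<Rightarrow> real"
  assumes q: "1 < q"
    and conj: "1 / p + 1 / q = 1"
    and weights: "\<And>j. 1 \<le> j \<Longrightarrow> 0 < \<gamma> j \<and> \<gamma> j \<le> 1"
  shows
    "((strongly_polynomially_tractable q \<gamma> \<longrightarrow> \<gamma> \<longlonglongrightarrow> 0) \<and>
      (antimono_on {1..} \<gamma> \<longrightarrow>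
         weakly_tractable q \<gamma> \<or> polynomially_tractable q \<gamma> \<longrightarrow> \<gamma> \<longlonglongrightarrow> 0))
     \<and>
     ((strongly_polynomially_tractable q \<gamma> \<longrightarrow> summable (\<lambda>j. \<gamma> (Suc j) powr (p / 2))) \<and>
      ((\<exists>l::nat. 1 \<le> l \<and> q = 2 * real l / (2 * real l - 1)) \<longrightarrow>
         summable (\<lambda>j. \<gamma> (Suc j) powr (p / 2)) \<longrightarrow> strongly_polynomially_tractable q \<gamma>))
     \<and>
     ((polynomially_tractable q \<gamma> \<longleftrightarrow>
         limsup (\<lambda>d. ereal (1 / ln (real d) * (\<Sum>j=1..d. \<gamma> j powr (p / 2)))) < \<infinity>) \<and>
      (limsup (\<lambda>d. ereal (1 / ln (real d) * (\<Sum>j=1..d. \<gamma> j powr (1 / 2)))) < \<infinity> \<longrightarrow>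
         polynomially_tractable \<infinity> \<gamma>))
     \<and>
     ((weakly_tractable q \<gamma> \<longleftrightarrow>
         (\<lambda>d. 1 / real d * (\<Sum>j=1..d. \<gamma> j powr (p / 2))) \<longlonglongrightarrow> 0) \<and>
      ((\<lambda>d. 1 / real d * (\<Sum>j=1..d. \<gamma> j powr (1 / 2))) \<longlonglongrightarrow> 0 \<longrightarrow>
         weakly_tractable \<infinity> \<gamma>))"
proof -
  have qp: "conj_exponents (ereal q) p" and inf: "conj_exponents \<infinity> 1"
    using q conj by (auto simp: conj_exponents_def)
  have p: "0 < p" using conj_exponents_bounds(2)[OF qp] by simp
  have SPT: "strongly_polynomially_tractable q \<gamma> \<longleftrightarrow> summable (\<lambda>j. \<gamma> (Suc j) powr (p / 2))"
    using strongly_polynomially_tractableI[where \<gamma> = \<gamma>, OF weights qp]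
      strongly_polynomially_tractableD[where \<gamma> = \<gamma>, OF weights q conj] by blast
  have PT: "polynomially_tractable q \<gamma> \<longleftrightarrow> limsup (\<lambda>d. ereal (1 / ln (real d) * weight_sum p \<gamma> d)) < \<infinity>"
    using polynomially_tractableI[where \<gamma> = \<gamma>, OF weights qp]
      polynomially_tractableD[where \<gamma> = \<gamma>, OF weights q conj] by blast
  have WT: "weakly_tractable q \<gamma> \<longleftrightarrow> (\<lambda>d. 1 / real d * weight_sum p \<gamma> d) \<longlonglongrightarrow> 0"
    using weakly_tractableI[where \<gamma> = \<gamma>, OF weights qp]
      weakly_tractableD[where \<gamma> = \<gamma>, OF weights q conj] by blast
  have "\<gamma> \<longlonglongrightarrow> 0" if "strongly_polynomially_tractable q \<gamma>"
  proof -
    have "(\<lambda>j. \<gamma> (Suc j) powr (p / 2)) \<longlonglongrightarrow> 0"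
      using that unfolding SPT by (rule summable_LIMSEQ_zero)
    then have "(\<lambda>j. \<gamma> j powr (p / 2)) \<longlonglongrightarrow> 0"
      by (rule LIMSEQ_imp_Suc)
    then show ?thesis by (rule weights_tendsto_0[where \<gamma> = \<gamma>, OF weights p, rotated])
  qed
  moreover have "\<gamma> \<longlonglongrightarrow> 0"
    if "antimono_on {1..} \<gamma>" "weakly_tractable q \<gamma> \<or> polynomially_tractable q \<gamma>"
  proof (rule antimono_weights_tendsto_0[where \<gamma> = \<gamma>, OF weights p that(1)])
    show "(\<lambda>d. 1 / real d * weight_sum p \<gamma> d) \<longlonglongrightarrow> 0"
      using that(2) WT polynomially_tractable_imp_average[where \<gamma> = \<gamma>, OF weights q conj] by blast
  qed
  ultimately show ?thesis
    using SPT PT WT polynomially_tractableI[where \<gamma> = \<gamma>, OF weights inf]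
      weakly_tractableI[where \<gamma> = \<gamma>, OF weights inf]
    unfolding weight_sum_def by (intro conjI impI) (blast | simp)+
qed

end
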